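(* Suppose that a regular cardinal number $\kappa$ is a caliber of Radon measures. Let $K$ and $L$ be compact spaces. If $K$ is $\kappa$-Corson compact and $T:C(L)\to C(K)$ is an isomorphic embedding, then $L$ is $\kappa$-Corson compact.
   Context: Compact spaces are Hausdorff and regular cardinals are infinite. For an infinite cardinal $\kappa$ and a set $\Gamma$, $\Sigma_\kappa(\mathbb{R}^\Gamma)=\{x\in\mathbb{R}^\Gamma:\ |\{\gamma\in\Gamma:x(\gamma)\neq0\}|<\kappa\}$ with the topology inherited from the product. A compact space is $\kappa$-Corson compact if it is homeomorphic to a subset of $\Sigma_\kappa(\mathbb{R}^\Gamma)$ for some set $\Gamma$. $C(K)$ is the Banach space of continuous real-valued functions on $K$ with the supremum norm. An isomorphic embedding is a bounded linear operator $T$ that is an isomorphism onto its range (i.e. $\|Tg\|\ge c\|g\|$ for some $c>0$ and all $g$). A regular cardinal $\kappa$ is a caliber of Radon measures if, for every compact space $K$, every regular Borel probability measure $\mu$ on $K$ and every family $\{A_\alpha:\alpha<\kappa\}$ of Borel subsets of $K$ with $\mu(A_\alpha)>0$ for all $\alpha$, there is $x\in K$ such that $\{\alpha<\kappa:x\in A_\alpha\}$ has cardinality $\kappa$. *)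

theory Defs
  imports "HOL-Analysis.Analysis"
begin

unbundle cardinal_syntax

text \<open>Cardinals are cardinal orders \<open>\<kappa> :: 'c rel\<close> in the sense of
  \<^theory>\<open>HOL.BNF_Cardinal_Order_Relation\<close>; the index set \<open>{\<alpha>. \<alpha> < \<kappa>}\<close> is \<open>Field \<kappa>\<close>.\<close>

definition regular_cardinal :: "'c rel \<Rightarrow> bool" where
  "regular_cardinal \<kappa> \<longleftrightarrow> Cinfinite \<kappa> \<and> regularCard \<kappa>"

definition Sigma_space :: "'c rel \<Rightarrow> 'g set \<Rightarrow> ('g \<Rightarrow> real) topology" where
  "Sigma_space \<kappa> \<Gamma> =
     subtopology (product_topology (\<lambda>_. euclideanreal) \<Gamma>) {x. |{\<gamma> \<in> \<Gamma>. x \<gamma> \<noteq> 0}| <o \<kappa>}"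

text \<open>An existential quantifier cannot range over all types, so the index set \<open>\<Gamma>\<close> is taken in the
  type \<open>'a \<Rightarrow> real\<close>. Nothing is lost: by lemma \<open>Corson_compactI\<close> below, an embedding with an index set
  in any other type yields one of this form (index by the coordinate functions themselves).\<close>

definition Corson_compact :: "'c rel \<Rightarrow> 'a topology \<Rightarrow> bool" where
  "Corson_compact \<kappa> X \<longleftrightarrow> compact_space X \<and> Hausdorff_space X \<and>
     (\<exists>(\<Gamma> :: ('a \<Rightarrow> real) set) S. S \<subseteq> topspace (Sigma_space \<kappa> \<Gamma>) \<and>
        X homeomorphic_space subtopology (Sigma_space \<kappa> \<Gamma>) S)"

lemma Corson_compactI:
  fixes \<Gamma> :: "'g set" and X :: "'a topology"
  assumes X: "compact_space X" "Hausdorff_space X"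
    and S: "S \<subseteq> topspace (Sigma_space \<kappa> \<Gamma>)"
    and hom: "X homeomorphic_space subtopology (Sigma_space \<kappa> \<Gamma>) S"
  shows "Corson_compact \<kappa> X"
proof -
  let ?P = "\<lambda>\<Gamma>. product_topology (\<lambda>_. euclideanreal) \<Gamma>"
  obtain f where f: "homeomorphic_map X (subtopology (Sigma_space \<kappa> \<Gamma>) S) f"
    using hom homeomorphic_space by blast
  define h where "h \<gamma> = (\<lambda>x. if x \<in> topspace X then f x \<gamma> else 0)" for \<gamma>
  define \<Delta> where "\<Delta> = h ` \<Gamma>"
  define g where "g x = (\<lambda>\<phi>\<in>\<Delta>. \<phi> x)" for x
  have cf: "continuous_map X (?P \<Gamma>) f"
    using homeomorphic_imp_continuous_map[OF f]
    by (simp add: Sigma_space_def continuous_map_in_subtopology)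
  have fS: "f x \<in> S" if "x \<in> topspace X" for x
    using homeomorphic_imp_surjective_map[OF f] that by auto
  have fSig: "f x \<in> topspace (Sigma_space \<kappa> \<Gamma>)" if "x \<in> topspace X" for x
    using fS S that by blast
  have cg: "continuous_map X (?P \<Delta>) g"
    unfolding continuous_map_componentwise
  proof (intro conjI ballI)
    show "g ` topspace X \<subseteq> extensional \<Delta>" by (auto simp: g_def)
    fix \<phi> assume "\<phi> \<in> \<Delta>"
    then obtain \<gamma> where \<gamma>: "\<gamma> \<in> \<Gamma>" "\<phi> = h \<gamma>" by (auto simp: \<Delta>_def)
    have "continuous_map X euclideanreal (\<lambda>x. f x \<gamma>)"
      using cf \<gamma> by (auto simp: continuous_map_componentwise)
    then show "continuous_map X euclideanreal (\<lambda>x. g x \<phi>)"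
      using \<open>\<phi> \<in> \<Delta>\<close> by (elim continuous_map_eq) (simp add: g_def \<gamma> h_def)
  qed
  have inj: "inj_on g (topspace X)"
  proof (rule inj_onI)
    fix x y assume xy: "x \<in> topspace X" "y \<in> topspace X" and eq: "g x = g y"
    have "f x \<gamma> = f y \<gamma>" if "\<gamma> \<in> \<Gamma>" for \<gamma>
      using fun_cong[OF eq, of "h \<gamma>"] that xy by (simp add: g_def \<Delta>_def h_def)
    moreover have "f x \<in> extensional \<Gamma>" "f y \<in> extensional \<Gamma>"
      using fSig xy by (auto simp: Sigma_space_def PiE_def)
    ultimately have "f x = f y" by (meson extensionalityI)
    then show "x = y"
      using homeomorphic_imp_injective_map[OF f] xy by (auto dest: inj_onD)
  qed
  have gS: "g ` topspace X \<subseteq> topspace (Sigma_space \<kappa> \<Delta>)"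
  proof
    fix z assume "z \<in> g ` topspace X"
    then obtain x where x: "x \<in> topspace X" "z = g x" by blast
    have "{\<phi> \<in> \<Delta>. g x \<phi> \<noteq> 0} \<subseteq> h ` {\<gamma> \<in> \<Gamma>. f x \<gamma> \<noteq> 0}"
      using x by (auto simp: \<Delta>_def g_def h_def)
    then have "|{\<phi> \<in> \<Delta>. g x \<phi> \<noteq> 0}| \<le>o |{\<gamma> \<in> \<Gamma>. f x \<gamma> \<noteq> 0}|"
      using card_of_mono1 card_of_image ordLeq_transitive by blast
    moreover have "|{\<gamma> \<in> \<Gamma>. f x \<gamma> \<noteq> 0}| <o \<kappa>"
      using fSig[OF x(1)] by (simp add: Sigma_space_def)
    ultimately have "|{\<phi> \<in> \<Delta>. g x \<phi> \<noteq> 0}| <o \<kappa>"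
      by (rule ordLeq_ordLess_trans)
    then show "z \<in> topspace (Sigma_space \<kappa> \<Delta>)"
      using x by (simp add: Sigma_space_def g_def)
  qed
  let ?Y = "subtopology (Sigma_space \<kappa> \<Delta>) (g ` topspace X)"
  have "continuous_map X ?Y g"
    using cg gS by (auto simp: Sigma_space_def continuous_map_in_subtopology)
  moreover have "Hausdorff_space ?Y"
    by (auto simp: Sigma_space_def Hausdorff_space_product_topology
        intro!: Hausdorff_space_subtopology)
  moreover have "g ` topspace X = topspace ?Y"
    using gS by auto
  ultimately have "homeomorphic_map X ?Y g"
    using X(1) inj by (simp only: continuous_imp_homeomorphic_map)
  then have "X homeomorphic_space ?Y"
    by (rule homeomorphic_map_imp_homeomorphic_space)
  then show ?thesis
    unfolding Corson_compact_def using X gS by (intro conjI exI)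
qed

definition regular_Borel_probability :: "'a topology \<Rightarrow> 'a measure \<Rightarrow> bool" where
  "regular_Borel_probability X M \<longleftrightarrow>
     space M = topspace X \<and>
     sets M = sigma_sets (topspace X) {U. openin X U} \<and>
     emeasure M (space M) = 1 \<and>
     (\<forall>A \<in> sets M.
        emeasure M A = (SUP C \<in> {C. compactin X C \<and> C \<subseteq> A}. emeasure M C) \<and>
        emeasure M A = (INF U \<in> {U. openin X U \<and> A \<subseteq> U}. emeasure M U))"

text \<open>A quantifier inside a formula cannot range over the compact spaces of all types. For
  \<open>\<kappa> :: 'c rel\<close> the points of the test spaces are taken in the type \<open>'c \<Rightarrow> real\<close>, with an arbitrary
  topology on an arbitrary carrier; this includes all compact subspaces of the power of the real
  line with exponent \<open>\<kappa>\<close>, in particular the Cantor cube \<open>{0,1}\<close> to the power \<open>\<kappa>\<close>.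

  Mathematically this is no restriction. Given any compact \<open>K\<close>, \<open>\<mu>\<close> and \<open>A\<^sub>\<alpha>\<close> (\<open>\<alpha> < \<kappa>\<close>), shrink the
  \<open>A\<^sub>\<alpha>\<close> to compact sets \<open>F\<^sub>\<alpha>\<close> of positive measure. The closed subalgebra that the \<open>F\<^sub>\<alpha>\<close> generate in the
  measure algebra of \<open>\<mu>\<close> has Maharam type at most \<open>\<kappa>\<close>, hence embeds into the measure algebra of the
  Cantor cube. Take Borel sets of positive measure inside the images of the classes of the \<open>F\<^sub>\<alpha>\<close>
  under a lifting of the latter. A point of the cube lying in \<open>\<kappa>\<close> many of these shows that the
  corresponding \<open>F\<^sub>\<alpha>\<close> have the finite intersection property, hence a common point in \<open>K\<close>.\<close>

definition caliber_of_Radon_measures :: "'c rel \<Rightarrow> bool" where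
  "caliber_of_Radon_measures \<kappa> \<longleftrightarrow>
     (\<forall>(X :: ('c \<Rightarrow> real) topology) M A.
        compact_space X \<longrightarrow> Hausdorff_space X \<longrightarrow> regular_Borel_probability X M \<longrightarrow>
        (\<forall>\<alpha> \<in> Field \<kappa>. A \<alpha> \<in> sets M \<and> emeasure M (A \<alpha>) > 0) \<longrightarrow>
        (\<exists>x \<in> topspace X. |{\<alpha> \<in> Field \<kappa>. x \<in> A \<alpha>}| =o \<kappa>))"

definition isomorphic_embedding ::
    "('a::real_normed_vector \<Rightarrow> 'b::real_normed_vector) \<Rightarrow> bool" where
  "isomorphic_embedding T \<longleftrightarrow> bounded_linear T \<and> (\<exists>c>0. \<forall>g. c * norm g \<le> norm (T g))"

end

theory Submission
  imports Defs
begin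

text \<open>
  Let \<open>K\<close> lie in a \<open>\<Sigma>\<^sub>\<kappa>\<close>-product with coordinates \<open>e\<^sub>\<gamma>\<close>, \<open>\<gamma> \<in> \<Gamma>\<close>. If \<open>\<phi>\<close> is a bounded functional on
  \<open>C(K)\<close> and \<open>e\<^sub>\<gamma>\<close> is nonzero on a set of positive variation for \<open>\<kappa>\<close> many \<open>\<gamma>\<close>, then pushing the variation
  forward along these coordinates gives a Radon measure on a compact subset of \<open>\<real>\<^sup>\<kappa>\<close>, and the caliber yields a
  point of \<open>K\<close> with \<open>\<kappa>\<close> many nonzero coordinates, a contradiction. Hence \<open>\<phi>\<close> is nonzero on fewer than \<open>\<kappa>\<close>
  monomials in the \<open>e\<^sub>\<gamma>\<close>. These monomials are linearly dense, so evaluation at them embeds every dual ball of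
  \<open>C(K)\<close> into a \<open>\<Sigma>\<^sub>\<kappa>\<close>-product. By the Hahn-Banach theorem \<open>L\<close> is a continuous image of the compact set of
  those functionals \<open>\<phi>\<close> in a suitable ball for which \<open>\<phi> \<circ> T\<close> is evaluation at a point of \<open>L\<close>. It remains
  that continuous images of compact subsets of \<open>\<Sigma>\<^sub>\<kappa>\<close>-products are \<open>\<kappa>\<close>-Corson for regular uncountable \<open>\<kappa>\<close>.
  This is an induction on the number of coordinates along a continuous chain of retractions, restricting
  points to larger and larger sets of coordinates, that are compatible with the map.
\<close>

subsection \<open>Small sets and finitary closures\<close>

text \<open>The detour through continuous images is forced. An evaluation functional of L, carried
  over to the range of T, has many extensions to C(K), and a continuous choice of extensions would
  make this range complemented. So only the set of all extensions is available; it maps onto L, but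
  need not contain a copy of L that is tied to T. The obstacle in the theorem on continuous images
  is that coordinates of the compact set do not descend along the map. Functions on the image are
  obtained by retracting first, with retractions that respect the equality kernel of the map. Sets
  of coordinates that allow this arise by closing under the supports of finite approximating nets of
  the kernel. Regularity keeps unions of fewer than \<kappa> small sets small. Uncountability enters
  because nets are taken for every precision 1/n, and because a single coordinate already has
  infinitely many powers. It is not an assumption: the caliber hypothesis excludes \<omega>.\<close>

definition uncountable_regular :: "'c rel \<Rightarrow> bool" where
  "uncountable_regular r \<longleftrightarrow> Cinfinite r \<and> regularCard r \<and> natLeq <o r"

lemma small_UN:
  assumes "uncountable_regular r" "|I| <o r" "\<And>i. i \<in> I \<Longrightarrow> |A i| <o r"
  shows "|\<Union>i\<in>I. A i| <o r"
  using card_of_UNION_ordLess_infinite_Field_regularCard[of r I A] assms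
  by (auto simp: uncountable_regular_def)

lemma small_subset: "|B| <o r \<Longrightarrow> A \<subseteq> B \<Longrightarrow> |A| <o r"
  by (meson card_of_mono1 ordLeq_ordLess_trans)

lemma small_image: "|A| <o r \<Longrightarrow> |f ` A| <o r"
  by (meson card_of_image ordLeq_ordLess_trans)

lemma small_countable:
  assumes "uncountable_regular r" "countable A"
  shows "|A| <o r"
proof -
  have "|A| \<le>o |UNIV::nat set|"
    using assms(2) by (meson countableE card_of_ordLeqI subset_UNIV UNIV_I)
  then have "|A| \<le>o natLeq"
    using card_of_nat ordLeq_ordIso_trans by blast
  then show ?thesis
    using assms(1) ordLeq_ordLess_trans uncountable_regular_def by blast
qed

lemma small_Un:
  assumes "uncountable_regular r" "|A| <o r" "|B| <o r"
  shows "|A \<union> B| <o r"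
proof -
  have "|\<Union>b\<in>UNIV. if b then A else B| <o r"
    by (rule small_UN[OF assms(1)]) (use assms in \<open>auto intro: small_countable\<close>)
  then show ?thesis
    by (simp add: UNIV_bool Un_commute)
qed

lemma small_Times:
  assumes "uncountable_regular r" "|A| <o r" "|B| <o r"
  shows "|A \<times> B| <o r"
proof -
  have "|\<Union>a\<in>A. Pair a ` B| <o r"
    using assms by (intro small_UN small_image)
  moreover have "(\<Union>a\<in>A. Pair a ` B) = A \<times> B"
    by auto
  ultimately show ?thesis
    by simp
qed

text \<open>Length splits the lists into countably many classes, each small by induction.
  Uncountability is essential: one letter already gives infinitely many lists.\<close>

lemma small_lists:
  assumes "uncountable_regular r" "|A| <o r"
  shows "|lists A| <o r"
proof -
  have "|{l \<in> lists A. length l = n}| <o r" for n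
  proof (induction n)
    case 0
    have "{l \<in> lists A. length l = 0} \<subseteq> {[]}"
      by auto
    then show ?case
      by (rule small_subset[rotated]) (simp add: assms(1) small_countable)
  next
    case (Suc n)
    have "{l \<in> lists A. length l = Suc n} \<subseteq> (\<lambda>(a, l). a # l) ` (A \<times> {l \<in> lists A. length l = n})"
      by (force simp: length_Suc_conv)
    then show ?case
      by (rule small_subset[rotated]) (intro small_image small_Times assms Suc)
  qed
  then have "|\<Union>n. {l \<in> lists A. length l = n}| <o r"
    by (intro small_UN[OF assms(1)]) (simp_all add: small_countable[OF assms(1)])
  moreover have "(\<Union>n. {l \<in> lists A. length l = n}) = lists A"
    by auto
  ultimately show ?thesis
    by simp
qed

lemma small_Fpow:
  assumes "uncountable_regular r" "|A| <o r"
  shows "|Fpow A| <o r"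
proof -
  have "Fpow A \<subseteq> set ` lists A"
  proof
    fix F assume "F \<in> Fpow A"
    then obtain l where "set l = F" "set l \<subseteq> A"
      by (metis (mono_tags, lifting) Fpow_def finite_list mem_Collect_eq)
    then show "F \<in> set ` lists A"
      by auto
  qed
  then show ?thesis
    by (rule small_subset[rotated]) (intro small_image small_lists assms)
qed

text \<open>Serves to count sets of size at most \<open>|S|\<close> when \<open>S\<close> is no
  longer small for \<open>r\<close>: relative to the successor of \<open>|S|\<close>, which is again
  regular and uncountable, such sets are exactly the small ones.\<close>

lemma uncountable_regular_cardSuc:
  assumes "uncountable_regular r" "r \<le>o |S|"
  shows "uncountable_regular (cardSuc |S| )" "|S| <o cardSuc |S|" "r \<le>o cardSuc |S|"
    "|X| <o cardSuc |S| \<Longrightarrow> |X| \<le>o |S|"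
proof -
  have inf: "Cinfinite |S|"
    using assms by (meson Cinfinite_cong card_of_Card_order cinfinite_mono uncountable_regular_def)
  show lt: "|S| <o cardSuc |S|"
    by (simp add: card_of_Card_order cardSuc_greater)
  then show le: "r \<le>o cardSuc |S|"
    using assms(2) ordLeq_transitive ordLess_imp_ordLeq by blast
  show "uncountable_regular (cardSuc |S| )"
    using inf Cinfinite_cardSuc regularCard_cardSuc ordLess_ordLeq_trans[OF _ le] assms(1)
    by (auto simp: uncountable_regular_def)
  show "|X| <o cardSuc |S| \<Longrightarrow> |X| \<le>o |S|"
    by (simp add: card_of_Card_order cardSuc_ordLeq_ordLess)
qed

section \<open>Hulls under an operation on finite sets\<close>

definition closure_step :: "('g set \<Rightarrow> 'g set) \<Rightarrow> 'g set \<Rightarrow> 'g set" where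
  "closure_step \<sigma> A = A \<union> (\<Union>F\<in>Fpow A. \<sigma> F)"

text \<open>As \<open>\<sigma>\<close> is applied to finite sets only, a finite subset of the limit
  lies in some finite stage, so \<omega> steps reach closure. In the application
  \<open>\<sigma> F\<close> carries the supports of nets that approximate a compact relation on
  \<open>F\<close>.\<close>

definition closed_hull :: "('g set \<Rightarrow> 'g set) \<Rightarrow> 'g set \<Rightarrow> 'g set" where
  "closed_hull \<sigma> S = (\<Union>n. (closure_step \<sigma> ^^ n) S)"

lemma small_closed_hull:
  assumes "uncountable_regular r" "\<And>F. finite F \<Longrightarrow> |\<sigma> F| <o r" "|S| <o r"
  shows "|closed_hull \<sigma> S| <o r"
proof -
  have "|(closure_step \<sigma> ^^ n) S| <o r" for n
  proof (induction n)
    case (Suc n)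
    then show ?case
      unfolding closure_step_def using assms
      by (auto simp: Fpow_def intro!: small_Un small_UN small_Fpow[unfolded Fpow_def])
  qed (use assms in simp)
  then show ?thesis
    unfolding closed_hull_def by (intro small_UN[OF assms(1)]) (simp_all add: small_countable[OF assms(1)])
qed

text \<open>The cardinal of \<open>\<Gamma>\<close> may be singular, so sets smaller than
  \<open>\<Gamma>\<close> cannot be handled as small sets for \<open>|\<Gamma>|\<close>. If
  \<open>S\<close> is not small for \<open>r\<close>, counting relative to the successor of
  \<open>|S|\<close> bounds the hull by \<open>|S|\<close> itself.\<close>

lemma closed_hull_card_less:
  assumes r: "uncountable_regular r" and \<sigma>: "\<And>F. finite F \<Longrightarrow> |\<sigma> F| <o r"
    and "r \<le>o |\<Gamma>|" "|S| <o |\<Gamma>|"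
  shows "|closed_hull \<sigma> S| <o |\<Gamma>|"
proof (cases "|S| <o r")
  case True
  then show ?thesis
    by (intro ordLess_ordLeq_trans[OF small_closed_hull[OF r \<sigma>] assms(3)])
next
  case False
  then have le: "r \<le>o |S|"
    using r ordLess_or_ordLeq[OF card_of_Well_order, of r S]
    by (auto simp: uncountable_regular_def card_order_on_def)
  note c = uncountable_regular_cardSuc[OF r le]
  have "|closed_hull \<sigma> S| <o cardSuc |S|"
    by (intro small_closed_hull[OF c(1) _ c(2)] ordLess_ordLeq_trans[OF \<sigma> c(3)])
  then show ?thesis
    by (intro ordLeq_ordLess_trans[OF c(4) assms(4)])
qed

lemma subset_closed_hull: "S \<subseteq> closed_hull \<sigma> S"
proof -
  have "(closure_step \<sigma> ^^ 0) S \<subseteq> closed_hull \<sigma> S"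
    unfolding closed_hull_def by blast
  then show ?thesis by simp
qed

lemma closure_step_mono:
  assumes "A \<subseteq> B" shows "closure_step \<sigma> A \<subseteq> closure_step \<sigma> B"
proof -
  have "Fpow A \<subseteq> Fpow B" by (rule Fpow_mono[OF assms])
  then have "(\<Union>F\<in>Fpow A. \<sigma> F) \<subseteq> (\<Union>F\<in>Fpow B. \<sigma> F)" by (rule UN_mono) (rule order_refl)
  then show ?thesis unfolding closure_step_def using assms by (rule Un_mono[rotated])
qed

lemma closure_step_extensive: "A \<subseteq> closure_step \<sigma> A"
  unfolding closure_step_def by blast

lemma closure_step_iter_mono:
  assumes "m \<le> n"
  shows "(closure_step \<sigma> ^^ m) S \<subseteq> (closure_step \<sigma> ^^ n) S"
  by (rule lift_Suc_mono_le[OF _ assms]) (simp add: closure_step_extensive)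

lemma finite_subset_closed_hull:
  assumes "finite F" "F \<subseteq> closed_hull \<sigma> S"
  shows "\<sigma> F \<subseteq> closed_hull \<sigma> S"
proof -
  have "\<exists>n. F \<subseteq> (closure_step \<sigma> ^^ n) S"
    using assms
  proof (induction F rule: finite_induct)
    case (insert x F)
    then obtain n m where "F \<subseteq> (closure_step \<sigma> ^^ n) S" "x \<in> (closure_step \<sigma> ^^ m) S"
      by (auto simp: closed_hull_def)
    then have "insert x F \<subseteq> (closure_step \<sigma> ^^ (max n m)) S"
      using closure_step_iter_mono[of n "max n m"] closure_step_iter_mono[of m "max n m"]
      by (smt (verit, best) insert_subset max.cobounded1 max.cobounded2 subset_iff)
    then show ?case ..
  qed simp
  then obtain n where "F \<subseteq> (closure_step \<sigma> ^^ n) S" ..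
  then have "\<sigma> F \<subseteq> (closure_step \<sigma> ^^ Suc n) S"
    using assms(1) by (auto simp: closure_step_def Fpow_def)
  then show ?thesis
    unfolding closed_hull_def by blast
qed

lemma closed_hull_least:
  assumes "S \<subseteq> B" "\<And>F. finite F \<Longrightarrow> F \<subseteq> B \<Longrightarrow> \<sigma> F \<subseteq> B"
  shows "closed_hull \<sigma> S \<subseteq> B"
proof -
  have "(closure_step \<sigma> ^^ n) S \<subseteq> B" for n
  proof (induction n)
    case (Suc n)
    have "(\<Union>F\<in>Fpow B. \<sigma> F) \<subseteq> B"
      using assms(2) by (intro UN_least) (simp add: Fpow_def)
    moreover have "closure_step \<sigma> ((closure_step \<sigma> ^^ n) S) \<subseteq> closure_step \<sigma> B"
      using Suc by (rule closure_step_mono)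
    ultimately show ?case
      by (simp add: closure_step_def[of \<sigma> B] Un_absorb2)
  qed (use assms in simp)
  then show ?thesis
    unfolding closed_hull_def by blast
qed

lemma closed_hull_mono: "S \<subseteq> T \<Longrightarrow> closed_hull \<sigma> S \<subseteq> closed_hull \<sigma> T"
  by (rule closed_hull_least) (meson subset_closed_hull order_trans, rule finite_subset_closed_hull)

lemma finite_subset_directed_Union:
  assumes "\<C> \<noteq> {}" "\<And>A B. A \<in> \<C> \<Longrightarrow> B \<in> \<C> \<Longrightarrow> A \<subseteq> B \<or> B \<subseteq> A" "finite F" "F \<subseteq> \<Union>\<C>"
  obtains A where "A \<in> \<C>" "F \<subseteq> A"
proof -
  have "\<exists>A\<in>\<C>. F \<subseteq> A"
    using assms(3,4)
  proof (induction F rule: finite_induct)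
    case empty
    then show ?case
      using assms(1) by blast
  next
    case (insert x F)
    then obtain A B where "A \<in> \<C>" "F \<subseteq> A" "B \<in> \<C>" "x \<in> B"
      by auto
    then show ?case
      using assms(2)[of A B] by blast
  qed
  then show ?thesis
    using that by blast
qed

text \<open>A finite subset of a union of a chain of hulls lies in one of them, so this union is
  already closed under \<open>\<sigma>\<close>. This is what makes the chain of retractions
  continuous at limits.\<close>

lemma closed_hull_Union_chain:
  assumes ne: "\<S> \<noteq> {}" and chain: "\<And>A B. A \<in> \<S> \<Longrightarrow> B \<in> \<S> \<Longrightarrow> A \<subseteq> B \<or> B \<subseteq> A"
  shows "closed_hull \<sigma> (\<Union>\<S>) = (\<Union>S\<in>\<S>. closed_hull \<sigma> S)"
proof
  show "closed_hull \<sigma> (\<Union>\<S>) \<subseteq> (\<Union>S\<in>\<S>. closed_hull \<sigma> S)"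
  proof (rule closed_hull_least)
    show "\<Union>\<S> \<subseteq> (\<Union>S\<in>\<S>. closed_hull \<sigma> S)"
      by (auto intro: subsetD[OF subset_closed_hull])
    fix F assume F: "finite F" "F \<subseteq> (\<Union>S\<in>\<S>. closed_hull \<sigma> S)"
    have chain': "A \<subseteq> B \<or> B \<subseteq> A" if "A \<in> closed_hull \<sigma> ` \<S>" "B \<in> closed_hull \<sigma> ` \<S>" for A B
    proof -
      from that obtain S T where "S \<in> \<S>" "A = closed_hull \<sigma> S" "T \<in> \<S>" "B = closed_hull \<sigma> T"
        by blast
      then show ?thesis
        using chain[of S T] closed_hull_mono[of S T \<sigma>] closed_hull_mono[of T S \<sigma>] by argo
    qed
    obtain A where A: "A \<in> closed_hull \<sigma> ` \<S>" "F \<subseteq> A"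
      by (rule finite_subset_directed_Union[OF _ chain' F]) (use ne in auto)
    then have "\<sigma> F \<subseteq> A"
      using finite_subset_closed_hull[OF F(1)] by auto
    then show "\<sigma> F \<subseteq> (\<Union>S\<in>\<S>. closed_hull \<sigma> S)"
      using A(1) by auto
  qed
  show "(\<Union>S\<in>\<S>. closed_hull \<sigma> S) \<subseteq> closed_hull \<sigma> (\<Union>\<S>)"
    by (intro UN_least closed_hull_mono Sup_upper)
qed

subsection \<open>Compact subsets of powers of the real line\<close>

lemma open_fun_basis:
  fixes x :: "'g \<Rightarrow> real"
  assumes "open W" "x \<in> W"
  obtains F e where "finite F" "e > 0" "\<And>u. (\<And>\<gamma>. \<gamma> \<in> F \<Longrightarrow> \<bar>u \<gamma> - x \<gamma>\<bar> < e) \<Longrightarrow> u \<in> W"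
proof -
  have "openin (product_topology (\<lambda>_. euclideanreal) UNIV) W"
    using assms by (simp add: euclidean_product_topology)
  from product_topology_open_contains_basis[OF this assms(2)]
  obtain X where X: "x \<in> Pi\<^sub>E UNIV X" "\<And>i. openin euclideanreal (X i)"
    "finite {i. X i \<noteq> topspace euclideanreal}" "Pi\<^sub>E UNIV X \<subseteq> W"
    by auto
  define F where "F = {i. X i \<noteq> UNIV}"
  have "\<exists>e>0. \<forall>y. \<bar>y - x i\<bar> < e \<longrightarrow> y \<in> X i" for i
    using X(1,2) by (metis PiE_E UNIV_I dist_real_def open_dist open_openin)
  then obtain e where e: "\<And>i. e i > 0" "\<And>i y. \<bar>y - x i\<bar> < e i \<Longrightarrow> y \<in> X i"
    by metis
  have fin: "finite F"
    using X(3) by (simp add: F_def)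
  show ?thesis
  proof
    show "finite F" by (rule fin)
    \<comment> \<open>The extra element 1 keeps the set nonempty when \<open>F\<close> is
      empty.\<close>
    show "Min (insert 1 (e ` F)) > 0"
      using fin e(1) by simp
    fix u assume u: "\<And>\<gamma>. \<gamma> \<in> F \<Longrightarrow> \<bar>u \<gamma> - x \<gamma>\<bar> < Min (insert 1 (e ` F))"
    have "u i \<in> X i" for i
    proof (cases "i \<in> F")
      case True
      then have "Min (insert 1 (e ` F)) \<le> e i"
        using fin by simp
      then show ?thesis
        using u[OF True] e(2) by force
    qed (simp add: F_def)
    then show "u \<in> W"
      using X(4) by auto
  qed
qed

lemma closed_fun_pairs:
  fixes R :: "(('g \<Rightarrow> real) \<times> ('g \<Rightarrow> real)) set"
  assumes "closed R"
    and approx: "\<And>F e. finite F \<Longrightarrow> e > 0 \<Longrightarrow>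
      \<exists>(u, u') \<in> R. \<forall>\<gamma>\<in>F. \<bar>u \<gamma> - x \<gamma>\<bar> < e \<and> \<bar>u' \<gamma> - x' \<gamma>\<bar> < e"
  shows "(x, x') \<in> R"
proof (rule ccontr)
  assume "(x, x') \<notin> R"
  then have "(x, x') \<in> - R" by simp
  then obtain A B where AB': "open A" "open B" "(x, x') \<in> A \<times> B" "A \<times> B \<subseteq> - R"
    by (rule open_prod_elim[OF open_Compl[OF assms(1)]])
  then have AB: "open A" "open B" "x \<in> A" "x' \<in> B" "A \<times> B \<subseteq> - R"
    by auto
  obtain F e where F: "finite F" "e > 0" "\<And>u. (\<And>\<gamma>. \<gamma> \<in> F \<Longrightarrow> \<bar>u \<gamma> - x \<gamma>\<bar> < e) \<Longrightarrow> u \<in> A"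
    using open_fun_basis[OF AB(1,3)] by metis
  obtain F' e' where F': "finite F'" "e' > 0" "\<And>u. (\<And>\<gamma>. \<gamma> \<in> F' \<Longrightarrow> \<bar>u \<gamma> - x' \<gamma>\<bar> < e') \<Longrightarrow> u \<in> B"
    using open_fun_basis[OF AB(2,4)] by metis
  obtain u u' where u: "(u, u') \<in> R"
    "\<forall>\<gamma>\<in>F \<union> F'. \<bar>u \<gamma> - x \<gamma>\<bar> < min e e' \<and> \<bar>u' \<gamma> - x' \<gamma>\<bar> < min e e'"
    using approx[of "F \<union> F'" "min e e'"] F F' by auto
  then have "u \<in> A" "u' \<in> B"
    using F(3) F'(3) by auto
  then show False
    using AB(5) u(1) by blast
qed

text \<open>Values outside \<open>A\<close> become 0 instead of being dropped, so that restriction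
  maps the full power of the line to itself and can be a retraction of a compact subset.\<close>

definition restr :: "'g set \<Rightarrow> ('g \<Rightarrow> real) \<Rightarrow> 'g \<Rightarrow> real" where
  "restr A x = (\<lambda>\<gamma>. if \<gamma> \<in> A then x \<gamma> else 0)"

lemma continuous_on_restr: "continuous_on S (restr A)"
proof -
  have "continuous_on S (\<lambda>x. restr A x \<gamma>)" for \<gamma>
    by (cases "\<gamma> \<in> A")
      (auto simp: restr_def intro: continuous_on_subset[OF continuous_on_product_coordinates])
  then show ?thesis
    by (rule continuous_on_coordinatewise_then_product)
qed

lemma restr_restr: "A \<subseteq> B \<Longrightarrow> restr B (restr A x) = restr A x"
  by (auto simp: restr_def fun_eq_iff)

text \<open>On finitely many coordinates the restriction to the union agrees with the restriction to
  a single member of the chain. Hence it is a pointwise limit of points of the closed set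
  \<open>R\<close>.\<close>

lemma restr_Union_chain:
  assumes "closed R" "\<C> \<noteq> {}" "\<And>A B. A \<in> \<C> \<Longrightarrow> B \<in> \<C> \<Longrightarrow> A \<subseteq> B \<or> B \<subseteq> A"
    and R: "\<And>A. A \<in> \<C> \<Longrightarrow> (restr A x, restr A x') \<in> R"
  shows "(restr (\<Union>\<C>) x, restr (\<Union>\<C>) x') \<in> R"
proof (rule closed_fun_pairs[OF assms(1)])
  fix F :: "'a set" and e :: real assume "finite F" "e > 0"
  then have "finite (F \<inter> \<Union>\<C>)" by simp
  with assms(2,3) obtain A where A: "A \<in> \<C>" "F \<inter> \<Union>\<C> \<subseteq> A"
    by (rule finite_subset_directed_Union) auto
  have "restr A z \<gamma> = restr (\<Union>\<C>) z \<gamma>" if "\<gamma> \<in> F" for z \<gamma>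
    using A that by (auto simp: restr_def)
  then show "\<exists>(u, u') \<in> R. \<forall>\<gamma>\<in>F. \<bar>u \<gamma> - restr (\<Union>\<C>) x \<gamma>\<bar> < e \<and> \<bar>u' \<gamma> - restr (\<Union>\<C>) x' \<gamma>\<bar> < e"
    using \<open>e > 0\<close> by (intro bexI[OF _ R[OF A(1)]]) simp
qed

lemma finite_net:
  fixes R :: "(('g \<Rightarrow> real) \<times> ('g \<Rightarrow> real)) set"
  assumes "compact R" "finite F" "e > 0"
  shows "\<exists>C. finite C \<and> C \<subseteq> R \<and> (\<forall>(x, x') \<in> R. \<exists>(u, u') \<in> C. \<forall>\<gamma>\<in>F. \<bar>u \<gamma> - x \<gamma>\<bar> < e \<and> \<bar>u' \<gamma> - x' \<gamma>\<bar> < e)"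
proof -
  define W where "W p = (\<Inter>\<gamma>\<in>F. {q. \<bar>fst p \<gamma> - fst q \<gamma>\<bar> < e} \<inter> {q. \<bar>snd p \<gamma> - snd q \<gamma>\<bar> < e})"
    for p :: "('g \<Rightarrow> real) \<times> ('g \<Rightarrow> real)"
  have c: "continuous_on UNIV (\<lambda>q :: ('g \<Rightarrow> real) \<times> ('g \<Rightarrow> real). fst q \<gamma>)"
    "continuous_on UNIV (\<lambda>q :: ('g \<Rightarrow> real) \<times> ('g \<Rightarrow> real). snd q \<gamma>)" for \<gamma>
    by (intro continuous_on_product_then_coordinatewise[of UNIV fst] continuous_on_fst continuous_on_id
        continuous_on_product_then_coordinatewise[of UNIV snd] continuous_on_snd)+
  have "open (W p)" for p
    unfolding W_def using assms(2)
    by (intro open_INT ballI open_Int open_Collect_less continuous_intros c) auto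
  moreover have "R \<subseteq> (\<Union>p\<in>R. W p)"
    using assms(3) by (auto simp: W_def)
  ultimately obtain C where "C \<subseteq> R" "finite C" "R \<subseteq> (\<Union>p\<in>C. W p)"
    using compactE_image[OF assms(1), of R W] by metis
  then show ?thesis
    by (intro exI[of _ C]) (fastforce simp: W_def)
qed

text \<open>For each \<open>n\<close> finitely many points of \<open>R\<close> approximate all of
  \<open>R\<close> on \<open>F\<close> up to 1/(n+1). \<open>N\<close> collects the supports of all
  these points, a countable union of small sets.\<close>

lemma support_nets:
  fixes R :: "(('g \<Rightarrow> real) \<times> ('g \<Rightarrow> real)) set"
  assumes r: "uncountable_regular r" and "compact R"
    and supp: "\<And>u u'. (u, u') \<in> R \<Longrightarrow> |{\<gamma>. u \<gamma> \<noteq> 0}| <o r \<and> |{\<gamma>. u' \<gamma> \<noteq> 0}| <o r"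
    and F: "finite F"
  shows "\<exists>N. |N| <o r \<and> (\<forall>x x' e. (x, x') \<in> R \<longrightarrow> e > 0 \<longrightarrow>
    (\<exists>(u, u') \<in> R. {\<gamma>. u \<gamma> \<noteq> 0} \<subseteq> N \<and> {\<gamma>. u' \<gamma> \<noteq> 0} \<subseteq> N \<and>
      (\<forall>\<gamma>\<in>F. \<bar>u \<gamma> - x \<gamma>\<bar> < e \<and> \<bar>u' \<gamma> - x' \<gamma>\<bar> < e)))"
proof -
  have "\<forall>n. \<exists>C. finite C \<and> C \<subseteq> R \<and> (\<forall>(x, x') \<in> R. \<exists>(u, u') \<in> C. \<forall>\<gamma>\<in>F.
      \<bar>u \<gamma> - x \<gamma>\<bar> < 1 / real (Suc n) \<and> \<bar>u' \<gamma> - x' \<gamma>\<bar> < 1 / real (Suc n))"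
    by (intro allI finite_net[OF assms(2) F]) simp
  from choice[OF this] obtain C where C: "\<forall>n. finite (C n) \<and> C n \<subseteq> R \<and>
      (\<forall>(x, x') \<in> R. \<exists>(u, u') \<in> C n. \<forall>\<gamma>\<in>F.
      \<bar>u \<gamma> - x \<gamma>\<bar> < 1 / real (Suc n) \<and> \<bar>u' \<gamma> - x' \<gamma>\<bar> < 1 / real (Suc n))" ..
  define N where "N = (\<Union>n. \<Union>p\<in>C n. {\<gamma>. fst p \<gamma> \<noteq> 0} \<union> {\<gamma>. snd p \<gamma> \<noteq> 0})"
  have "|{\<gamma>. fst p \<gamma> \<noteq> 0} \<union> {\<gamma>. snd p \<gamma> \<noteq> 0}| <o r" if "p \<in> C n" for n p
    using that C supp[of "fst p" "snd p"] by (intro small_Un[OF r]) auto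
  moreover have "|C n| <o r" for n
    using C r by (simp add: small_countable countable_finite)
  ultimately have "|\<Union>p\<in>C n. {\<gamma>. fst p \<gamma> \<noteq> 0} \<union> {\<gamma>. snd p \<gamma> \<noteq> 0}| <o r" for n
    by (intro small_UN[OF r])
  then have "|N| <o r"
    unfolding N_def by (rule small_UN[OF r, rotated]) (simp_all add: small_countable[OF r])
  moreover have "\<exists>(u, u') \<in> R. {\<gamma>. u \<gamma> \<noteq> 0} \<subseteq> N \<and> {\<gamma>. u' \<gamma> \<noteq> 0} \<subseteq> N \<and>
      (\<forall>\<gamma>\<in>F. \<bar>u \<gamma> - x \<gamma>\<bar> < e \<and> \<bar>u' \<gamma> - x' \<gamma>\<bar> < e)"
    if xx: "(x, x') \<in> R" and e: "e > 0" for x x' e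
  proof -
    obtain n where n: "1 / real (Suc n) < e"
      using e nat_approx_posE by auto
    obtain u u' where u: "(u, u') \<in> C n"
      "\<forall>\<gamma>\<in>F. \<bar>u \<gamma> - x \<gamma>\<bar> < 1 / real (Suc n) \<and> \<bar>u' \<gamma> - x' \<gamma>\<bar> < 1 / real (Suc n)"
      using C xx by fast
    have "{\<gamma>. u \<gamma> \<noteq> 0} \<subseteq> N" "{\<gamma>. u' \<gamma> \<noteq> 0} \<subseteq> N"
      using u(1) by (force simp: N_def)+
    moreover have "(u, u') \<in> R"
      using u(1) C by blast
    moreover have "\<forall>\<gamma>\<in>F. \<bar>u \<gamma> - x \<gamma>\<bar> < e \<and> \<bar>u' \<gamma> - x' \<gamma>\<bar> < e"
      using u(2) n by (meson less_trans)
    ultimately show ?thesis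
      by blast
  qed
  ultimately show ?thesis
    by blast
qed

text \<open>Closing a set of coordinates under the supports of finite nets of \<open>R\<close> makes restriction to it a retraction of \<open>R\<close>.\<close>

lemma restr_closed_hull_closed:
  fixes R :: "(('g \<Rightarrow> real) \<times> ('g \<Rightarrow> real)) set"
  assumes "closed R" "(x, x') \<in> R"
    and \<sigma>: "\<And>F e. finite F \<Longrightarrow> e > 0 \<Longrightarrow>
    (\<exists>(u, u') \<in> R. {\<gamma>. u \<gamma> \<noteq> 0} \<subseteq> \<sigma> F \<and> {\<gamma>. u' \<gamma> \<noteq> 0} \<subseteq> \<sigma> F \<and>
      (\<forall>\<gamma>\<in>F. \<bar>u \<gamma> - x \<gamma>\<bar> < e \<and> \<bar>u' \<gamma> - x' \<gamma>\<bar> < e))"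
  shows "(restr (closed_hull \<sigma> S) x, restr (closed_hull \<sigma> S) x') \<in> R"
proof (rule closed_fun_pairs[OF assms(1)])
  fix F :: "'g set" and e :: real assume F: "finite F" "e > 0"
  let ?A = "closed_hull \<sigma> S"
  \<comment> \<open>Approximation is requested only on \<open>F \<inter> ?A\<close>. On the rest of
    \<open>F\<close> it is exact: the approximating points are supported in
    \<open>\<sigma> (F \<inter> ?A)\<close>, hence in \<open>?A\<close>, so they vanish there like
    the restrictions.\<close>
  have "\<sigma> (F \<inter> ?A) \<subseteq> ?A"
    using F(1) by (intro finite_subset_closed_hull) auto
  moreover obtain u u' where u: "(u, u') \<in> R" "{\<gamma>. u \<gamma> \<noteq> 0} \<subseteq> \<sigma> (F \<inter> ?A)" "{\<gamma>. u' \<gamma> \<noteq> 0} \<subseteq> \<sigma> (F \<inter> ?A)"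
      "\<forall>\<gamma>\<in>F \<inter> ?A. \<bar>u \<gamma> - x \<gamma>\<bar> < e \<and> \<bar>u' \<gamma> - x' \<gamma>\<bar> < e"
    using \<sigma>[of "F \<inter> ?A" e] F by fast
  ultimately have "u \<gamma> = 0" "u' \<gamma> = 0" if "\<gamma> \<notin> ?A" for \<gamma>
    using that by blast+
  then have "\<forall>\<gamma>\<in>F. \<bar>u \<gamma> - restr ?A x \<gamma>\<bar> < e \<and> \<bar>u' \<gamma> - restr ?A x' \<gamma>\<bar> < e"
    using u(4) F(2) by (auto simp: restr_def)
  then show "\<exists>(u, u') \<in> R. \<forall>\<gamma>\<in>F. \<bar>u \<gamma> - restr ?A x \<gamma>\<bar> < e \<and> \<bar>u' \<gamma> - restr ?A x' \<gamma>\<bar> < e"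
    using u(1) by blast
qed

text \<open>A continuous map from a compact set to a Hausdorff space is closed, hence a quotient map
  onto its image, and \<open>h\<close> is the map induced by \<open>g\<close> on the
  quotient.\<close>

lemma continuous_on_compact_factor:
  fixes f :: "'x::topological_space \<Rightarrow> 'y::topological_space" and g :: "'x \<Rightarrow> 'z::topological_space"
  assumes Y: "Hausdorff_space (euclidean :: 'y topology)"
    and "compact H" "continuous_on H f" "continuous_on H g" "\<And>x. x \<in> H \<Longrightarrow> h (f x) = g x"
  shows "continuous_on (f ` H) h"
  unfolding continuous_on_closed_invariant
proof (intro allI impI)
  fix B :: "'z set" assume "closed B"
  then obtain A where A: "closed A" "A \<inter> H = g -` B \<inter> H"
    using assms(4) unfolding continuous_on_closed_invariant by blast
  have "compact (A \<inter> H)"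
    using compact_Int_closed[OF assms(2) A(1)] by (simp only: Int_commute)
  then have "compact (f ` (A \<inter> H))"
    by (intro compact_continuous_image continuous_on_subset[OF assms(3)]) auto
  then have "closed (f ` (A \<inter> H))"
    using compactin_imp_closedin[OF Y] by simp
  moreover have "f ` (A \<inter> H) \<inter> f ` H = h -` B \<inter> f ` H"
    using A(2) assms(5) by fastforce
  ultimately show "\<exists>A. closed A \<and> A \<inter> f ` H = h -` B \<inter> f ` H"
    by blast
qed

lemma Hausdorff_space_euclidean_t2: "Hausdorff_space (euclidean :: 'l::t2_space topology)"
  unfolding Hausdorff_space_def using hausdorff by (fastforce simp: disjnt_def)

lemma compact_separating_function:
  fixes y y' :: "'l::t2_space"
  assumes "compact S" "y \<in> S" "y' \<in> S" "y \<noteq> y'"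
  obtains g :: "'l \<Rightarrow> real" where "continuous_on S g" "g y \<noteq> g y'"
proof -
  have "normal_space (top_of_set S)"
    using assms(1)
    by (intro compact_Hausdorff_or_regular_imp_normal_space disjI1 Hausdorff_space_subtopology)
      (simp_all add: compact_space_subtopology Hausdorff_space_euclidean_t2)
  moreover have "closedin (top_of_set S) {y}" "closedin (top_of_set S) {y'}"
    using assms by (simp_all add: closedin_closed_subset)
  ultimately obtain g where "continuous_map (top_of_set S) euclideanreal g" "g ` {y} \<subseteq> {0}" "g ` {y'} \<subseteq> {1}"
    using Urysohn_lemma_alt[of "top_of_set S" "{y}" "{y'}" 0 1] assms(4) by (auto simp: disjnt_def)
  then show ?thesis
    using that by auto
qed

subsection \<open>Continuous images of compact sets with small supports\<close>

text \<open>For compact \<open>S\<close>, the coordinate functions of an embedding of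
  \<open>S\<close> into a \<Sigma>-product. Working with functions on \<open>S\<close> itself
  removes the index set.\<close>

definition separating_family :: "'c rel \<Rightarrow> 'l::topological_space set \<Rightarrow> ('l \<Rightarrow> real) set \<Rightarrow> bool" where
  "separating_family r S D \<longleftrightarrow> (\<forall>d\<in>D. continuous_on S d) \<and> (\<forall>y\<in>S. |{d\<in>D. d y \<noteq> 0}| <o r) \<and>
    (\<forall>y\<in>S. \<forall>y'\<in>S. y \<noteq> y' \<longrightarrow> (\<exists>d\<in>D. d y \<noteq> d y'))"

text \<open>Basic open sets of the product, coded by lists so that \<open>small_lists\<close> counts
  those with rational bounds and coordinates in a small set.\<close>

definition coord_box :: "('g \<times> real \<times> real) list \<Rightarrow> ('g \<Rightarrow> real) set" where
  "coord_box l = {x. \<forall>(\<gamma>, a, b) \<in> set l. a < x \<gamma> \<and> x \<gamma> < b}"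

lemma coord_box_neighbourhood:
  assumes "open W" "x \<in> W" and supp: "\<And>u. u \<in> insert x H \<Longrightarrow> {\<gamma>. u \<gamma> \<noteq> 0} \<subseteq> \<Gamma>"
  obtains l where "l \<in> lists (\<Gamma> \<times> \<rat> \<times> \<rat>)" "x \<in> coord_box l" "coord_box l \<inter> H \<subseteq> W"
proof -
  obtain F e where F: "finite F" "e > 0" "\<And>u. (\<And>\<gamma>. \<gamma> \<in> F \<Longrightarrow> \<bar>u \<gamma> - x \<gamma>\<bar> < e) \<Longrightarrow> u \<in> W"
    using open_fun_basis[OF assms(1,2)] by metis
  have "\<exists>a\<in>\<rat>. x \<gamma> - e < a \<and> a < x \<gamma>" "\<exists>b\<in>\<rat>. x \<gamma> < b \<and> b < x \<gamma> + e" for \<gamma>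
    using F(2) by (simp_all add: Rats_dense_in_real)
  then obtain a b where ab: "\<And>\<gamma>. a \<gamma> \<in> \<rat>" "\<And>\<gamma>. b \<gamma> \<in> \<rat>" "\<And>\<gamma>. x \<gamma> - e < a \<gamma>" "\<And>\<gamma>. a \<gamma> < x \<gamma>"
      "\<And>\<gamma>. x \<gamma> < b \<gamma>" "\<And>\<gamma>. b \<gamma> < x \<gamma> + e"
    by metis
  \<comment> \<open>Coordinates outside \<open>\<Gamma>\<close> vanish at all points concerned, so
    constraining those in \<open>\<Gamma>\<close> is enough.\<close>
  obtain fl where fl: "set fl = F \<inter> \<Gamma>"
    using F(1) finite_list[of "F \<inter> \<Gamma>"] by auto
  define l where "l = map (\<lambda>\<gamma>. (\<gamma>, a \<gamma>, b \<gamma>)) fl"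
  have "u \<in> W" if u: "u \<in> coord_box l" "u \<in> H" for u
  proof (rule F(3))
    fix \<gamma> assume "\<gamma> \<in> F"
    show "\<bar>u \<gamma> - x \<gamma>\<bar> < e"
    proof (cases "\<gamma> \<in> \<Gamma>")
      case True
      then have "a \<gamma> < u \<gamma>" "u \<gamma> < b \<gamma>"
        using u(1) fl \<open>\<gamma> \<in> F\<close> by (auto simp: coord_box_def l_def)
      then show ?thesis
        using ab(3,6)[of \<gamma>] by linarith
    next
      case False
      then have "u \<gamma> = 0" "x \<gamma> = 0"
        using supp[of u] supp[of x] u(2) by blast+
      then show ?thesis
        using F(2) by simp
    qed
  qed
  moreover have "l \<in> lists (\<Gamma> \<times> \<rat> \<times> \<rat>)" "x \<in> coord_box l"
    using ab fl by (auto simp: l_def coord_box_def)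
  ultimately show ?thesis
    using that by blast
qed

text \<open>A weight argument: there are few pairs of rational boxes, and one function is chosen for
  each pair that some continuous function on the image tells apart. The whole family is small, so
  the condition on the number of nonzero values is automatic.\<close>

lemma separating_family_small:
  fixes f :: "('g \<Rightarrow> real) \<Rightarrow> 'l::t2_space" and r :: "'c rel"
  assumes r: "uncountable_regular r" and "|\<Gamma>| <o r" and H: "compact H" "continuous_on H f"
    and supp: "\<And>u. u \<in> H \<Longrightarrow> {\<gamma>. u \<gamma> \<noteq> 0} \<subseteq> \<Gamma>"
  shows "\<exists>D. separating_family r (f ` H) D"
proof -
  define L where "L = lists (\<Gamma> \<times> (\<rat> :: real set) \<times> (\<rat> :: real set))"
  define good where "good p g \<longleftrightarrow> continuous_on (f ` H) g \<and>
    (\<forall>u \<in> coord_box (fst p) \<inter> H. \<forall>u' \<in> coord_box (snd p) \<inter> H. g (f u) \<noteq> g (f u'))"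
    for p and g :: "'l \<Rightarrow> real"
  define G where "G p = (SOME g. good p g)" for p
  define D where "D = G ` {p \<in> L \<times> L. \<exists>g. good p g}"
  have G: "good p (G p)" if "good p g" for p g
    unfolding G_def using that by (rule someI[of "good p"])
  have "|L| <o r"
    unfolding L_def using assms(1,2)
    by (intro small_lists small_Times) (simp_all add: small_countable countable_rat)
  then have LL: "|L \<times> L| <o r"
    by (intro small_Times[OF r])
  have D: "|D| <o r"
    unfolding D_def by (rule small_image[OF small_subset[OF LL]]) auto
  have "\<exists>d\<in>D. d y \<noteq> d y'" if y: "y \<in> f ` H" "y' \<in> f ` H" "y \<noteq> y'" for y y'
  proof -
    obtain g :: "'l \<Rightarrow> real" where g: "continuous_on (f ` H) g" "g y \<noteq> g y'"
      using compact_separating_function[OF compact_continuous_image[OF H(2,1)] y] .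
    obtain x x' where x: "x \<in> H" "y = f x" "x' \<in> H" "y' = f x'"
      using y by blast
    obtain O1 O2 where O12: "open O1" "open O2" "g y \<in> O1" "g y' \<in> O2" "O1 \<inter> O2 = {}"
      using hausdorff[OF g(2)] by blast
    have "continuous_on H (\<lambda>x. g (f x))"
      by (rule continuous_on_compose2[OF g(1) H(2)]) simp
    then obtain W1 W2 where W: "open W1" "W1 \<inter> H = (\<lambda>x. g (f x)) -` O1 \<inter> H"
        "open W2" "W2 \<inter> H = (\<lambda>x. g (f x)) -` O2 \<inter> H"
      unfolding continuous_on_open_invariant using O12(1,2) by metis
    have xW: "x \<in> W1" "x' \<in> W2"
      using W x O12 by auto
    obtain l1 where l1: "l1 \<in> L" "x \<in> coord_box l1" "coord_box l1 \<inter> H \<subseteq> W1"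
      unfolding L_def by (rule coord_box_neighbourhood[OF W(1) xW(1), of H \<Gamma>]) (use supp x(1) in auto)
    obtain l2 where l2: "l2 \<in> L" "x' \<in> coord_box l2" "coord_box l2 \<inter> H \<subseteq> W2"
      unfolding L_def by (rule coord_box_neighbourhood[OF W(3) xW(2), of H \<Gamma>]) (use supp x(3) in auto)
    have "good (l1, l2) g"
      unfolding good_def
    proof (intro conjI ballI g(1))
      fix u u' assume "u \<in> coord_box (fst (l1, l2)) \<inter> H" "u' \<in> coord_box (snd (l1, l2)) \<inter> H"
      then have "g (f u) \<in> O1" "g (f u') \<in> O2"
        using l1(3) l2(3) W(2,4) by auto
      then show "g (f u) \<noteq> g (f u')"
        using O12(5) by auto
    qed
    then have "good (l1, l2) (G (l1, l2))" "G (l1, l2) \<in> D"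
      using G l1(1) l2(1) by (auto simp: D_def)
    then show ?thesis
      using l1(2) l2(2) x by (auto simp: good_def)
  qed
  moreover have "continuous_on (f ` H) d" if "d \<in> D" for d
    using that G by (auto simp: D_def good_def)
  moreover have "|{d\<in>D. d y \<noteq> 0}| <o r" for y
    by (rule small_subset[OF D]) auto
  ultimately show ?thesis
    unfolding separating_family_def by blast
qed

lemma Hausdorff_space_euclidean_fun: "Hausdorff_space (euclidean :: ('g \<Rightarrow> real) topology)"
  by (simp add: Hausdorff_space_product_topology flip: euclidean_product_topology)

lemma compact_imp_closed_fun_pairs:
  fixes R :: "(('g \<Rightarrow> real) \<times> ('g \<Rightarrow> real)) set"
  assumes "compact R"
  shows "closed R"
proof -
  have "Hausdorff_space (euclidean :: (('g \<Rightarrow> real) \<times> ('g \<Rightarrow> real)) topology)"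
    by (simp add: Hausdorff_space_prod_topology Hausdorff_space_euclidean_fun flip: prod_topology_euclidean)
  then show ?thesis
    using compactin_imp_closedin[of euclidean R] assms by simp
qed

text \<open>With \<open>R\<close> the equality kernel of \<open>f\<close>, restriction to a set of coordinates that is closed for \<open>R\<close> maps \<open>H\<close> into
  itself and descends to \<open>f ` H\<close>. The hulls \<open>le \<alpha>\<close> of the initial segments of \<open>|\<Gamma>|\<close> form a continuous chain of
  such sets of smaller size. The family consists of the differences of the functions for \<open>le \<alpha>\<close> pulled back along
  two consecutive retractions; a point sees only those \<open>\<alpha>\<close> at which its restriction changes.\<close>

lemma separating_family_step:
  fixes f :: "('g \<Rightarrow> real) \<Rightarrow> 'l::t2_space" and r :: "'c rel"
  assumes r: "uncountable_regular r" and rG: "r \<le>o |\<Gamma>|" and H: "compact H" "continuous_on H f"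
    and supp: "\<And>u. u \<in> H \<Longrightarrow> {\<gamma>. u \<gamma> \<noteq> 0} \<subseteq> \<Gamma>" "\<And>u. u \<in> H \<Longrightarrow> |{\<gamma>. u \<gamma> \<noteq> 0}| <o r"
    and IH: "\<And>\<Delta> H'. |\<Delta>| <o |\<Gamma>| \<Longrightarrow> compact H' \<Longrightarrow> H' \<subseteq> H \<Longrightarrow>
      (\<And>u. u \<in> H' \<Longrightarrow> {\<gamma>. u \<gamma> \<noteq> 0} \<subseteq> \<Delta>) \<Longrightarrow> \<exists>D. separating_family r (f ` H') D"
  shows "\<exists>D. separating_family r (f ` H) D"
proof -
  define R where "R = {p \<in> H \<times> H. f (fst p) = f (snd p)}"
  have "compact R"
  proof -
    have "continuous_on (H \<times> H) (\<lambda>p. (f (fst p), f (snd p)))"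
      by (intro continuous_on_Pair continuous_on_compose2[OF H(2)] continuous_on_fst continuous_on_snd
          continuous_on_id) auto
    then obtain A where "closed A" "A \<inter> (H \<times> H) = (\<lambda>p. (f (fst p), f (snd p))) -` {p. \<exists>y. p = (y, y)} \<inter> (H \<times> H)"
      unfolding continuous_on_closed_invariant using closed_diagonal by blast
    moreover have "\<dots> = R"
      by (auto simp: R_def)
    ultimately show ?thesis
      using compact_Int_closed[OF compact_Times[OF H(1) H(1)], of A] by (simp add: Int_commute)
  qed
  then have "closed R"
    by (rule compact_imp_closed_fun_pairs)
  have R_supp: "|{\<gamma>. u \<gamma> \<noteq> 0}| <o r \<and> |{\<gamma>. u' \<gamma> \<noteq> 0}| <o r" if "(u, u') \<in> R" for u u'
    using that supp(2) by (simp add: R_def)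
  have "\<forall>F. \<exists>N. finite F \<longrightarrow> |N| <o r \<and> (\<forall>x x' e. (x, x') \<in> R \<longrightarrow> e > 0 \<longrightarrow>
    (\<exists>(u, u') \<in> R. {\<gamma>. u \<gamma> \<noteq> 0} \<subseteq> N \<and> {\<gamma>. u' \<gamma> \<noteq> 0} \<subseteq> N \<and>
      (\<forall>\<gamma>\<in>F. \<bar>u \<gamma> - x \<gamma>\<bar> < e \<and> \<bar>u' \<gamma> - x' \<gamma>\<bar> < e)))"
    using support_nets[OF r \<open>compact R\<close> R_supp] by simp
  from choice[OF this] obtain \<sigma> where \<sigma>: "\<forall>F. finite F \<longrightarrow> |\<sigma> F| <o r \<and> (\<forall>x x' e. (x, x') \<in> R \<longrightarrow> e > 0 \<longrightarrow>
    (\<exists>(u, u') \<in> R. {\<gamma>. u \<gamma> \<noteq> 0} \<subseteq> \<sigma> F \<and> {\<gamma>. u' \<gamma> \<noteq> 0} \<subseteq> \<sigma> F \<and>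
      (\<forall>\<gamma>\<in>F. \<bar>u \<gamma> - x \<gamma>\<bar> < e \<and> \<bar>u' \<gamma> - x' \<gamma>\<bar> < e)))" ..
  have R_closed_hull: "(restr (closed_hull \<sigma> S) x, restr (closed_hull \<sigma> S) x') \<in> R" if "(x, x') \<in> R" for S x x'
    by (rule restr_closed_hull_closed[OF \<open>closed R\<close> that]) (use \<sigma> that in blast)
  have f_closed_hull: "f (restr (closed_hull \<sigma> S) x) = f (restr (closed_hull \<sigma> S) x')" if "x \<in> H" "x' \<in> H" "f x = f x'" for S x x'
    using R_closed_hull[of x x' S] that by (simp add: R_def)
  have H_closed_hull: "restr (closed_hull \<sigma> S) x \<in> H" if "x \<in> H" for S x
    using R_closed_hull[of x x S] that by (simp add: R_def)
  \<comment> \<open>Stage \<alpha> of the chain leads from \<open>lt \<alpha>\<close> to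
    \<open>le \<alpha>\<close>. By \<open>lt_Union\<close> the set \<open>lt \<alpha>\<close> is the
    union of all earlier \<open>le \<beta>\<close> when there are any, so limit and successor stages
    need no distinction.\<close>
  define le where "le \<alpha> = closed_hull \<sigma> (under |\<Gamma>| \<alpha>)" for \<alpha>
  define lt where "lt \<alpha> = closed_hull \<sigma> (underS |\<Gamma>| \<alpha>)" for \<alpha>
  have wo: "Well_order |\<Gamma>|"
    by (rule card_of_Well_order)
  have inf: "infinite \<Gamma>"
    using rG r card_of_ordLeq_infinite[of "Field r" \<Gamma>] card_of_Field_ordIso[of r]
    by (auto simp: uncountable_regular_def cinfinite_def intro: ordIso_ordLeq_trans)
  have fin_less: "|A| <o |\<Gamma>|" if "finite A" for A :: "'g set"
    using that inf by (intro finite_ordLess_infinite card_of_Well_order) (simp_all add: Field_card_of)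
  have small_lt: "|underS |\<Gamma>| \<alpha>| <o |\<Gamma>|" if "\<alpha> \<in> \<Gamma>" for \<alpha>
    using that by (intro card_of_underS card_of_Card_order) (simp add: Field_card_of)
  have small_le: "|under |\<Gamma>| \<alpha>| <o |\<Gamma>|" if "\<alpha> \<in> \<Gamma>" for \<alpha>
  proof -
    have "|underS |\<Gamma>| \<alpha> \<union> {\<alpha>}| <o |\<Gamma>|"
      using inf that by (intro card_of_Un_ordLess_infinite small_lt fin_less) auto
    then show ?thesis
      by (rule small_subset) (auto simp: under_def underS_def)
  qed
  have closed_hull_small: "|closed_hull \<sigma> S| <o |\<Gamma>|" if "|S| <o |\<Gamma>|" for S
    using closed_hull_card_less[OF r _ rG that, of \<sigma>] \<sigma> by blast
  have lt_le: "lt \<alpha> \<subseteq> le \<alpha>" for \<alpha>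
    unfolding lt_def le_def by (intro closed_hull_mono underS_subset_under)
  have trans: "trans |\<Gamma>|" and antisym: "antisym |\<Gamma>|" and refl: "Refl |\<Gamma>|" and total: "Total |\<Gamma>|"
    using wo by (auto simp: order_on_defs)
  have under_underS: "under |\<Gamma>| \<beta> \<subseteq> underS |\<Gamma>| \<alpha>" if "\<beta> \<in> underS |\<Gamma>| \<alpha>" for \<alpha> \<beta>
    using that trans antisym unfolding under_def underS_def trans_def antisym_def by blast
  have le_lt: "le \<beta> \<subseteq> lt \<alpha>" if "\<beta> \<in> underS |\<Gamma>| \<alpha>" for \<alpha> \<beta>
    unfolding lt_def le_def using that by (intro closed_hull_mono under_underS)
  have self_under: "\<alpha> \<in> under |\<Gamma>| \<alpha>" if "\<alpha> \<in> \<Gamma>" for \<alpha>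
    using that refl by (auto simp: under_def refl_on_def Field_card_of)
  have comparable: "\<alpha> \<in> underS |\<Gamma>| \<beta> \<or> \<beta> \<in> underS |\<Gamma>| \<alpha>" if "\<alpha> \<in> \<Gamma>" "\<beta> \<in> \<Gamma>" "\<alpha> \<noteq> \<beta>" for \<alpha> \<beta>
    using that total unfolding total_on_def Field_card_of underS_def by blast
  have under_chain: "under |\<Gamma>| \<alpha> \<subseteq> under |\<Gamma>| \<beta> \<or> under |\<Gamma>| \<beta> \<subseteq> under |\<Gamma>| \<alpha>"
    if "\<alpha> \<in> \<Gamma>" "\<beta> \<in> \<Gamma>" for \<alpha> \<beta>
  proof -
    have "underS |\<Gamma>| \<gamma> \<subseteq> under |\<Gamma>| \<gamma>" for \<gamma>
      by (rule underS_subset_under)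
    then show ?thesis
      using comparable[OF that] under_underS by (metis order_refl order_trans)
  qed
  have underS_Field: "underS |\<Gamma>| \<alpha> \<subseteq> \<Gamma>" for \<alpha>
    using FieldI1[of _ \<alpha> "|\<Gamma>|"] by (auto simp: underS_def Field_card_of)
  have le_chain: "A \<subseteq> B \<or> B \<subseteq> A" if "A \<in> le ` S" "B \<in> le ` S" "S \<subseteq> \<Gamma>" for A B S
    using that under_chain closed_hull_mono unfolding le_def by (smt (verit, best) image_iff subsetD)
  have lt_Union: "lt \<alpha> = \<Union> (le ` underS |\<Gamma>| \<alpha>)" if "underS |\<Gamma>| \<alpha> \<noteq> {}" for \<alpha>
  proof -
    have "underS |\<Gamma>| \<alpha> = \<Union> (under |\<Gamma>| ` underS |\<Gamma>| \<alpha>)"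
    proof
      show "underS |\<Gamma>| \<alpha> \<subseteq> \<Union> (under |\<Gamma>| ` underS |\<Gamma>| \<alpha>)"
        using self_under underS_Field by blast
    qed (use under_underS in blast)
    then have "lt \<alpha> = closed_hull \<sigma> (\<Union> (under |\<Gamma>| ` underS |\<Gamma>| \<alpha>))"
      by (simp add: lt_def)
    also have "\<dots> = (\<Union>S\<in>under |\<Gamma>| ` underS |\<Gamma>| \<alpha>. closed_hull \<sigma> S)"
      by (rule closed_hull_Union_chain) (use that underS_Field under_chain in blast)+
    finally show ?thesis
      by (simp add: le_def image_image)
  qed
  have self_le: "\<alpha> \<in> le \<alpha>" if "\<alpha> \<in> \<Gamma>" for \<alpha>
    using that subset_closed_hull[of "under |\<Gamma>| \<alpha>" \<sigma>] self_under by (auto simp: le_def)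
  have "\<exists>D. separating_family r (f ` (restr (closed_hull \<sigma> S) ` H)) D" if "|S| <o |\<Gamma>|" for S
  proof (rule IH[OF closed_hull_small[OF that]])
    show "compact (restr (closed_hull \<sigma> S) ` H)"
      by (intro compact_continuous_image continuous_on_restr H)
    show "restr (closed_hull \<sigma> S) ` H \<subseteq> H"
      using H_closed_hull by blast
    show "{\<gamma>. u \<gamma> \<noteq> 0} \<subseteq> closed_hull \<sigma> S" if "u \<in> restr (closed_hull \<sigma> S) ` H" for u
      using that by (auto simp: restr_def split: if_splits)
  qed
  then have "\<forall>S. \<exists>D. |S| <o |\<Gamma>| \<longrightarrow> separating_family r (f ` (restr (closed_hull \<sigma> S) ` H)) D"
    by blast
  from choice[OF this] obtain E where E: "\<And>S. |S| <o |\<Gamma>| \<Longrightarrow> separating_family r (f ` (restr (closed_hull \<sigma> S) ` H)) (E S)"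
    by blast
  have E_le: "separating_family r (f ` (restr (le \<alpha>) ` H)) (E (under |\<Gamma>| \<alpha>))" if "\<alpha> \<in> \<Gamma>" for \<alpha>
    unfolding le_def by (rule E[OF small_le[OF that]])
  have E0: "separating_family r (f ` (restr (closed_hull \<sigma> {}) ` H)) (E {})"
    by (intro E fin_less) simp
  \<comment> \<open>Any preimage will do: by \<open>f_closed_hull\<close> the image of a retracted
    point depends only on the image of the point.\<close>
  define \<iota> where "\<iota> = inv_into H f"
  have \<iota>: "\<iota> (f x) \<in> H" "f (\<iota> (f x)) = f x" if "x \<in> H" for x
    using that by (auto simp: \<iota>_def inv_into_into f_inv_into_f)
  define lift where "lift \<alpha> d = (\<lambda>y. d (f (restr (le \<alpha>) (\<iota> y))) - d (f (restr (lt \<alpha>) (\<iota> y))))"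
    for \<alpha> and d :: "'l \<Rightarrow> real"
  \<comment> \<open>The start of the chain is the hull of the empty set, which need not be empty.
    Differences of consecutive stages cannot see it, so it gets functions of its own.\<close>
  define lift0 where "lift0 d = (\<lambda>y. d (f (restr (closed_hull \<sigma> {}) (\<iota> y))))" for d :: "'l \<Rightarrow> real"
  have lift_eq: "lift \<alpha> d (f x) = d (f (restr (le \<alpha>) x)) - d (f (restr (lt \<alpha>) x))" if "x \<in> H" for \<alpha> d x
    unfolding lift_def le_def lt_def using \<iota>[OF that] f_closed_hull[OF \<iota>(1)[OF that] that] by simp
  have lift0_eq: "lift0 d (f x) = d (f (restr (closed_hull \<sigma> {}) x))" if "x \<in> H" for d x
    unfolding lift0_def using \<iota>[OF that] f_closed_hull[OF \<iota>(1)[OF that] that] by simp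
  \<comment> \<open>Both terms of a lifted difference thus evaluate \<open>d\<close> on the image of
    the retract for \<open>le \<alpha>\<close>, the set on which its continuity and smallness are
    known.\<close>
  have lt_mem: "restr (lt \<alpha>) x \<in> restr (le \<alpha>) ` H" if "x \<in> H" for \<alpha> x
    using H_closed_hull[OF that, of "underS |\<Gamma>| \<alpha>"] restr_restr[OF lt_le] unfolding lt_def[symmetric] by (metis imageI)
  define D where "D = (\<Union>\<alpha>\<in>\<Gamma>. lift \<alpha> ` E (under |\<Gamma>| \<alpha>)) \<union> lift0 ` E {}"
  have cont_e: "continuous_on H (\<lambda>x. e (f (restr A x)))"
    if "continuous_on (f ` (restr B ` H)) e" "\<And>x. x \<in> H \<Longrightarrow> restr A x \<in> restr B ` H" "restr B ` H \<subseteq> H"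
    for A B and e :: "'l \<Rightarrow> real"
    by (rule continuous_on_compose2[OF that(1)],
        rule continuous_on_compose2[OF H(2) continuous_on_restr]) (use that(2,3) in blast)+
  have le_H: "restr (le \<alpha>) ` H \<subseteq> H" for \<alpha>
    unfolding le_def using H_closed_hull by blast
  have cont: "continuous_on (f ` H) d" if "d \<in> D" for d
  proof -
    from that consider (lift) \<alpha> e where "\<alpha> \<in> \<Gamma>" "e \<in> E (under |\<Gamma>| \<alpha>)" "d = lift \<alpha> e"
      | (lift0) e where "e \<in> E {}" "d = lift0 e"
      unfolding D_def by blast
    then show ?thesis
    proof cases
      case lift
      then have e: "continuous_on (f ` (restr (le \<alpha>) ` H)) e"
        using E_le by (simp add: separating_family_def)
      have "continuous_on H (\<lambda>x. e (f (restr (le \<alpha>) x)) - e (f (restr (lt \<alpha>) x)))"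
        by (intro continuous_on_diff cont_e[OF e] le_H lt_mem imageI)
      then show ?thesis
        by (rule continuous_on_compact_factor[OF Hausdorff_space_euclidean_t2 H]) (use lift_eq lift in simp)
    next
      case lift0
      then have e: "continuous_on (f ` (restr (closed_hull \<sigma> {}) ` H)) e"
        using E0 by (simp add: separating_family_def)
      have "continuous_on H (\<lambda>x. e (f (restr (closed_hull \<sigma> {}) x)))"
        by (rule cont_e[OF e]) (use H_closed_hull in blast)+
      then show ?thesis
        by (rule continuous_on_compact_factor[OF Hausdorff_space_euclidean_t2 H]) (use lift0_eq lift0 in simp)
    qed
  qed
  have small: "|{d\<in>D. d y \<noteq> 0}| <o r" if y: "y \<in> f ` H" for y
  proof -
    obtain x where x: "x \<in> H" "y = f x"
      using y by blast
    define M where "M = (\<Union>\<gamma>\<in>{\<gamma>. x \<gamma> \<noteq> 0}. {\<alpha> \<in> \<Gamma>. \<gamma> \<in> le \<alpha> - lt \<alpha>})"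
    define N where "N \<alpha> z = {e \<in> E (under |\<Gamma>| \<alpha>). e (f z) \<noteq> 0}" for \<alpha> z
    \<comment> \<open>The chain increases, so a coordinate enters it at one stage at most. Hence the
      stages that change \<open>x\<close> are no more numerous than its nonzero coordinates.\<close>
    have "|{\<alpha> \<in> \<Gamma>. \<gamma> \<in> le \<alpha> - lt \<alpha>}| <o r" for \<gamma>
    proof (cases "\<exists>\<alpha>. \<alpha> \<in> \<Gamma> \<and> \<gamma> \<in> le \<alpha> - lt \<alpha>")
      case True
      then obtain \<alpha> where "\<alpha> \<in> \<Gamma>" "\<gamma> \<in> le \<alpha> - lt \<alpha>" by blast
      then have "{\<alpha> \<in> \<Gamma>. \<gamma> \<in> le \<alpha> - lt \<alpha>} \<subseteq> {\<alpha>}"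
        using comparable le_lt by blast
      then show ?thesis
        by (rule small_subset[rotated]) (simp add: small_countable[OF r])
    next
      case False
      then have "{\<alpha> \<in> \<Gamma>. \<gamma> \<in> le \<alpha> - lt \<alpha>} \<subseteq> {}"
        by blast
      then show ?thesis
        by (rule small_subset[rotated]) (simp add: small_countable[OF r])
    qed
    then have "|M| <o r"
      unfolding M_def by (intro small_UN[OF r] supp(2) x(1))
    moreover have "|N \<alpha> z| <o r" if "\<alpha> \<in> \<Gamma>" "z \<in> restr (le \<alpha>) ` H" for \<alpha> z
      using E_le[OF that(1)] that(2) unfolding N_def separating_family_def by blast
    then have "|lift \<alpha> ` (N \<alpha> (restr (le \<alpha>) x) \<union> N \<alpha> (restr (lt \<alpha>) x))| <o r" if "\<alpha> \<in> M" for \<alpha>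
      using that x(1) by (intro small_image small_Un[OF r]) (auto simp: M_def lt_mem)
    ultimately have "|\<Union>\<alpha>\<in>M. lift \<alpha> ` (N \<alpha> (restr (le \<alpha>) x) \<union> N \<alpha> (restr (lt \<alpha>) x))| <o r"
      by (rule small_UN[OF r])
    moreover have "|lift0 ` {e \<in> E {}. e (f (restr (closed_hull \<sigma> {}) x)) \<noteq> 0}| <o r"
      using E0 x(1) unfolding separating_family_def by (intro small_image) blast
    moreover have "{d\<in>D. d y \<noteq> 0} \<subseteq> (\<Union>\<alpha>\<in>M. lift \<alpha> ` (N \<alpha> (restr (le \<alpha>) x) \<union> N \<alpha> (restr (lt \<alpha>) x)))
        \<union> lift0 ` {e \<in> E {}. e (f (restr (closed_hull \<sigma> {}) x)) \<noteq> 0}"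
    proof
      fix d assume d: "d \<in> {d\<in>D. d y \<noteq> 0}"
      then consider (lift) \<alpha> e where "\<alpha> \<in> \<Gamma>" "e \<in> E (under |\<Gamma>| \<alpha>)" "d = lift \<alpha> e"
        | (lift0) e where "e \<in> E {}" "d = lift0 e"
        unfolding D_def by blast
      then show "d \<in> (\<Union>\<alpha>\<in>M. lift \<alpha> ` (N \<alpha> (restr (le \<alpha>) x) \<union> N \<alpha> (restr (lt \<alpha>) x)))
        \<union> lift0 ` {e \<in> E {}. e (f (restr (closed_hull \<sigma> {}) x)) \<noteq> 0}"
      proof cases
        case lift
        then have ne: "e (f (restr (le \<alpha>) x)) \<noteq> e (f (restr (lt \<alpha>) x))"
          using d lift_eq[OF x(1)] x(2) by auto
        then have "restr (le \<alpha>) x \<noteq> restr (lt \<alpha>) x"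
          by auto
        then obtain \<gamma> where "restr (le \<alpha>) x \<gamma> \<noteq> restr (lt \<alpha>) x \<gamma>"
          by blast
        then have "x \<gamma> \<noteq> 0" "\<gamma> \<in> le \<alpha> - lt \<alpha>"
          using lt_le[of \<alpha>] by (auto simp: restr_def split: if_splits)
        then have "\<alpha> \<in> M"
          using lift(1) by (auto simp: M_def)
        moreover have "e \<in> N \<alpha> (restr (le \<alpha>) x) \<union> N \<alpha> (restr (lt \<alpha>) x)"
          using ne lift(2) by (auto simp: N_def)
        ultimately show ?thesis
          using lift(3) by blast
      next
        case lift0
        then show ?thesis
          using d lift0_eq[OF x(1)] x(2) by auto
      qed
    qed
    ultimately show ?thesis
      by (meson small_Un[OF r] small_subset)
  qed
  have sep: "y = y'" if y: "y \<in> f ` H" "y' \<in> f ` H" and eq: "\<And>d. d \<in> D \<Longrightarrow> d y = d y'" for y y'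
  proof -
    obtain x x' where x: "x \<in> H" "y = f x" "x' \<in> H" "y' = f x'"
      using y by blast
    have R_iff: "(restr (closed_hull \<sigma> S) x, restr (closed_hull \<sigma> S) x') \<in> R \<longleftrightarrow> f (restr (closed_hull \<sigma> S) x) = f (restr (closed_hull \<sigma> S) x')" for S
      using x H_closed_hull by (simp add: R_def)
    have sep_eq: "f (restr A x) = f (restr A x')" if E': "separating_family r (f ` (restr A ` H)) E'"
      "\<And>e. e \<in> E' \<Longrightarrow> e (f (restr A x)) = e (f (restr A x'))" for A E'
    proof (rule ccontr)
      assume "\<not> ?thesis"
      moreover have "f (restr A x) \<in> f ` (restr A ` H)" "f (restr A x') \<in> f ` (restr A ` H)"
        using x by auto
      ultimately have "\<exists>e\<in>E'. e (f (restr A x)) \<noteq> e (f (restr A x'))"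
        using E'(1) unfolding separating_family_def by blast
      then show False
        using E'(2) by blast
    qed
    have base: "f (restr (closed_hull \<sigma> {}) x) = f (restr (closed_hull \<sigma> {}) x')"
    proof (rule sep_eq[OF E0])
      fix e assume "e \<in> E {}"
      then have "lift0 e y = lift0 e y'"
        by (intro eq) (simp add: D_def)
      then show "e (f (restr (closed_hull \<sigma> {}) x)) = e (f (restr (closed_hull \<sigma> {}) x'))"
        using x lift0_eq by simp
    qed
    \<comment> \<open>Transfinite induction along the chain: closedness of \<open>R\<close> carries
      equality from all earlier \<open>le \<beta>\<close> to their union \<open>lt \<alpha>\<close>,
      and the lifted differences carry it from \<open>lt \<alpha>\<close> to
      \<open>le \<alpha>\<close>.\<close>
    have "wf ( |\<Gamma>| - Id)"
      using card_of_well_order_on[of \<Gamma>] by (simp add: well_order_on_def)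
    then have le_eq: "\<alpha> \<in> \<Gamma> \<longrightarrow> f (restr (le \<alpha>) x) = f (restr (le \<alpha>) x')" for \<alpha>
    proof (induction \<alpha> rule: wf_induct_rule)
      case (less \<alpha>)
      have IH: "(restr (le \<beta>) x, restr (le \<beta>) x') \<in> R" if "\<beta> \<in> underS |\<Gamma>| \<alpha>" for \<beta>
        using less[of \<beta>] that underS_Field[of \<alpha>] R_iff[of "under |\<Gamma>| \<beta>"] by (auto simp: underS_def le_def)
      have lt_eq: "f (restr (lt \<alpha>) x) = f (restr (lt \<alpha>) x')"
      proof (cases "underS |\<Gamma>| \<alpha> = {}")
        case True
        then show ?thesis
          using base by (simp add: lt_def)
      next
        case False
        have "(restr (lt \<alpha>) x, restr (lt \<alpha>) x') \<in> R"
          unfolding lt_Union[OF False]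
          by (rule restr_Union_chain[OF \<open>closed R\<close>]) (use False IH le_chain underS_Field in blast)+
        then show ?thesis
          by (simp add: R_def)
      qed
      show ?case
      proof
        assume \<alpha>: "\<alpha> \<in> \<Gamma>"
        show "f (restr (le \<alpha>) x) = f (restr (le \<alpha>) x')"
        proof (rule sep_eq[OF E_le[OF \<alpha>]])
          fix e assume "e \<in> E (under |\<Gamma>| \<alpha>)"
          then have "lift \<alpha> e y = lift \<alpha> e y'"
            using \<alpha> by (intro eq) (auto simp: D_def)
          then show "e (f (restr (le \<alpha>) x)) = e (f (restr (le \<alpha>) x'))"
            using x lift_eq lt_eq by simp
        qed
      qed
    qed
    have "\<Gamma> \<noteq> {}"
      using inf by auto
    moreover have "(restr (le \<alpha>) x, restr (le \<alpha>) x') \<in> R" if "\<alpha> \<in> \<Gamma>" for \<alpha>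
      using le_eq that R_iff by (simp add: le_def)
    ultimately have "(restr (\<Union> (le ` \<Gamma>)) x, restr (\<Union> (le ` \<Gamma>)) x') \<in> R"
      using restr_Union_chain[OF \<open>closed R\<close>, of "le ` \<Gamma>" x x'] le_chain[of _ \<Gamma>] by blast
    moreover have "restr (\<Union> (le ` \<Gamma>)) z = z" if "z \<in> H" for z
    proof
      fix \<gamma>
      have "z \<gamma> \<noteq> 0 \<Longrightarrow> \<gamma> \<in> \<Union> (le ` \<Gamma>)"
        using supp(1)[OF that] self_le[of \<gamma>] by blast
      then show "restr (\<Union> (le ` \<Gamma>)) z \<gamma> = z \<gamma>"
        unfolding restr_def by argo
    qed
    ultimately show ?thesis
      using x by (simp add: R_def)
  qed
  show ?thesis
    unfolding separating_family_def
  proof (intro exI[of _ D] conjI ballI impI)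
    fix y y' assume "y \<in> f ` H" "y' \<in> f ` H" "y \<noteq> y'"
    then show "\<exists>d\<in>D. d y \<noteq> d y'"
      using sep[of y y'] by blast
  qed (use cont small in auto)
qed

text \<open>Well-founded induction on the cardinality of a set \<open>\<Gamma>\<close> that carries
  all supports. The map \<open>f\<close> can stay fixed while \<open>H\<close> varies, because the
  retracts to which the hypothesis is applied are subsets of \<open>H\<close>.\<close>

theorem separating_family_continuous_image:
  fixes f :: "('g \<Rightarrow> real) \<Rightarrow> 'l::t2_space" and r :: "'c rel"
  assumes r: "uncountable_regular r" and "compact H" "continuous_on H f"
    and "\<And>u. u \<in> H \<Longrightarrow> |{\<gamma>. u \<gamma> \<noteq> 0}| <o r"
  shows "\<exists>D. separating_family r (f ` H) D"
proof -
  have "\<forall>H. compact H \<longrightarrow> continuous_on H f \<longrightarrow>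
      (\<forall>u\<in>H. |{\<gamma>. u \<gamma> \<noteq> 0}| <o r \<and> {\<gamma>. u \<gamma> \<noteq> 0} \<subseteq> \<Gamma>) \<longrightarrow> (\<exists>D. separating_family r (f ` H) D)" for \<Gamma>
  proof (induction \<Gamma> rule: wf_induct_rule[OF wf_inv_image[OF wf_ordLess, of card_of]])
    case (1 \<Gamma>)
    show ?case
    proof (intro allI impI)
      fix H assume H: "compact H" "continuous_on H f"
        "\<forall>u\<in>H. |{\<gamma>. u \<gamma> \<noteq> 0}| <o r \<and> {\<gamma>. u \<gamma> \<noteq> 0} \<subseteq> \<Gamma>"
      show "\<exists>D. separating_family r (f ` H) D"
      proof (cases "|\<Gamma>| <o r")
        case True
        then show ?thesis
          using separating_family_small[OF r True H(1,2)] H(3) by blast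
      next
        case False
        then have "r \<le>o |\<Gamma>|"
          using r ordLess_or_ordLeq[OF card_of_Well_order, of r \<Gamma>]
          by (auto simp: uncountable_regular_def card_order_on_def)
        then show ?thesis
        proof (rule separating_family_step[OF r _ H(1,2)])
          fix \<Delta> H' assume "|\<Delta>| <o |\<Gamma>|" "compact H'" "H' \<subseteq> H" "\<And>u. u \<in> H' \<Longrightarrow> {\<gamma>. u \<gamma> \<noteq> 0} \<subseteq> \<Delta>"
          then show "\<exists>D. separating_family r (f ` H') D"
            using 1[of \<Delta>] H(3) continuous_on_subset[OF H(2)] by (simp add: subset_iff)
        qed (use H(3) in auto)
      qed
    qed
  qed
  from this[of UNIV] show ?thesis
    using assms by simp
qed

subsection \<open>The variation measure of a functional\<close>

lemma bcontfun_times: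
  fixes g :: "'k::topological_space \<Rightarrow>\<^sub>C real" and u :: "'k \<Rightarrow> real"
  assumes "continuous_on UNIV u" "\<And>x. \<bar>u x\<bar> \<le> 1"
  obtains h :: "'k \<Rightarrow>\<^sub>C real" where "\<And>x. h x = g x * u x" "norm h \<le> norm g"
proof -
  have le: "\<bar>g x * u x\<bar> \<le> norm g" for x
    using norm_bounded[of g x] assms(2)[of x] mult_mono[of "\<bar>g x\<bar>" "norm g" "\<bar>u x\<bar>" 1]
    by (simp add: abs_mult)
  then have "(\<lambda>x. g x * u x) \<in> bcontfun"
    using assms(1) by (auto simp: bcontfun_def bounded_iff intro!: continuous_intros)
  then obtain h where h: "\<And>x. apply_bcontfun h x = g x * u x"
    by (metis bcontfunE)
  moreover have "norm h \<le> norm g"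
    by (rule norm_bound) (simp add: h le)
  ultimately show ?thesis
    using that by blast
qed

text \<open>\<open>ennreal\<close> cuts negative numbers off at 0, so equality can fail when the
  signs differ.\<close>

lemma ennreal_add_le: "ennreal (a + b) \<le> ennreal a + ennreal b"
proof -
  have "ennreal (a + b) \<le> ennreal (max 0 a + max 0 b)"
    by (rule ennreal_leI) linarith
  also have "\<dots> = ennreal (max 0 a) + ennreal (max 0 b)"
    by (rule ennreal_plus) auto
  finally show ?thesis
    by (simp add: max_def ennreal_neg split: if_splits)
qed

text \<open>The usual construction of the Riesz measure works for a signed functional as well and then yields its total
  variation, so no Jordan decomposition is needed.\<close>

locale variation =
  fixes X :: "'x topology" and \<pi> :: "'k::topological_space \<Rightarrow> 'x" and \<phi> :: "('k \<Rightarrow>\<^sub>C real) \<Rightarrow> real"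
  assumes X: "compact_space X" "Hausdorff_space X"
    and \<pi>: "continuous_map euclidean X \<pi>"
    and \<phi>: "bounded_linear \<phi>"
    and normalized: "(SUP g\<in>{g. norm g \<le> 1}. ennreal (\<phi> g)) = 1"
begin

text \<open>The test functions live on the source of \<open>\<pi>\<close>, but their carriers are
  measured in \<open>X\<close>; so the variation is pushed forward from the outset. That
  \<open>C\<close> is closed gives compactness in covering arguments and keeps \<open>V - C\<close>
  open.\<close>

definition adm :: "'x set \<Rightarrow> ('k \<Rightarrow>\<^sub>C real) set" where
  "adm U = {g. norm g \<le> 1 \<and> (\<exists>C. closedin X C \<and> C \<subseteq> U \<and> (\<forall>x. apply_bcontfun g x \<noteq> 0 \<longrightarrow> \<pi> x \<in> C))}"

text \<open>No absolute value is needed: \<open>adm U\<close> contains \<open>- g\<close> along with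
  \<open>g\<close>, and \<open>ennreal\<close> discards negative values.\<close>

definition var :: "'x set \<Rightarrow> ennreal" where
  "var U = (SUP g\<in>adm U. ennreal (\<phi> g))"

definition outer :: "'x set \<Rightarrow> ennreal" where
  "outer E = (INF U\<in>{U. openin X U \<and> E \<subseteq> U}. var U)"

lemma \<pi>_in: "\<pi> x \<in> topspace X"
  using \<pi> by (auto simp: continuous_map_def)

lemma \<phi>_0: "\<phi> 0 = 0" and \<phi>_add: "\<phi> (g + h) = \<phi> g + \<phi> h"
  using \<phi> by (simp_all add: linear_simps)

lemma zero_adm: "0 \<in> adm U"
  by (auto simp: adm_def intro!: exI[of _ "{}"])

lemma adm_ne: "adm U \<noteq> {}"
  using zero_adm by blast

lemma var_upper: "g \<in> adm U \<Longrightarrow> ennreal (\<phi> g) \<le> var U"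
  unfolding var_def by (rule SUP_upper)

lemma var_least: "(\<And>g. g \<in> adm U \<Longrightarrow> ennreal (\<phi> g) \<le> c) \<Longrightarrow> var U \<le> c"
  unfolding var_def by (rule SUP_least)

lemma adm_mono: "U \<subseteq> V \<Longrightarrow> adm U \<subseteq> adm V"
  unfolding adm_def by blast

lemma var_mono: "U \<subseteq> V \<Longrightarrow> var U \<le> var V"
  unfolding var_def using adm_mono by (intro SUP_subset_mono) auto

lemma var_empty: "var {} = 0"
proof -
  have "g = 0" if "g \<in> adm {}" for g
    by (rule bcontfun_eqI) (use that in \<open>auto simp: adm_def\<close>)
  then show ?thesis
    using var_least[of "{}" 0] \<phi>_0 by (metis ennreal_0 le_zero_eq order_refl)
qed

lemma var_topspace: "var (topspace X) = 1"
proof -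
  have "adm (topspace X) = {g. norm g \<le> 1}"
    using \<pi>_in by (auto simp: adm_def)
  then show ?thesis
    using normalized by (simp add: var_def)
qed

lemma normal_X: "normal_space X"
  using X compact_Hausdorff_or_regular_imp_normal_space by blast

lemma adm_split:
  assumes "openin X U" "openin X V" "g \<in> adm (U \<union> V)"
  obtains g1 g2 where "g = g1 + g2" "g1 \<in> adm U" "g2 \<in> adm V"
proof -
  obtain C where C: "closedin X C" "C \<subseteq> U \<union> V" "\<And>x. apply_bcontfun g x \<noteq> 0 \<Longrightarrow> \<pi> x \<in> C" and ng: "norm g \<le> 1"
    using assms(3) by (auto simp: adm_def)
  have "closedin X (C - V)" "closedin X (topspace X - U)"
    using C(1) assms by (auto simp: closedin_diff)
  moreover have "disjnt (topspace X - U) (C - V)"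
    using C(2) by (auto simp: disjnt_def)
  ultimately obtain k where k: "continuous_map X (top_of_set {0..1::real}) k"
      "k ` (topspace X - U) \<subseteq> {0}" "k ` (C - V) \<subseteq> {1}"
    using Urysohn_lemma[OF normal_X, of "topspace X - U" "C - V" 0 1] by auto
  have kc: "continuous_map X euclideanreal k"
    using k(1) by (simp add: continuous_map_in_subtopology)
  have closed_le: "closedin X {y \<in> topspace X. k y \<le> 2/3}" "closedin X {y \<in> topspace X. 1/3 \<le> k y}"
    using closedin_continuous_map_preimage[OF kc, of "{..2/3}"]
      closedin_continuous_map_preimage[OF kc, of "{1/3..}"] by auto
  \<comment> \<open>\<open>h\<close> is 0 where \<open>k\<close> is at most 1/3 and 1 where it is at
    least 2/3. This margin confines \<open>g1\<close> and \<open>g2\<close> to closed parts of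
    \<open>C\<close>; multiplying by \<open>k\<close> and \<open>1 - k\<close> would only confine
    them to relatively open ones.\<close>
  define h where "h x = min 1 (max 0 (3 * k (\<pi> x) - 1))" for x
  have "continuous_on UNIV (k \<circ> \<pi>)"
    using continuous_map_compose[OF \<pi> kc] by simp
  then have h: "continuous_on UNIV h" "continuous_on UNIV (\<lambda>x. 1 - h x)"
    unfolding h_def comp_def by (auto intro!: continuous_intros)
  have h01: "\<bar>h x\<bar> \<le> 1" "\<bar>1 - h x\<bar> \<le> 1" for x
    by (auto simp: h_def)
  obtain g1 where g1: "\<And>x. apply_bcontfun g1 x = g x * h x" "norm g1 \<le> norm g"
    using bcontfun_times[OF h(1) h01(1), of g] by blast
  obtain g2 where g2: "\<And>x. apply_bcontfun g2 x = g x * (1 - h x)" "norm g2 \<le> norm g"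
    using bcontfun_times[OF h(2) h01(2), of g] by blast
  show ?thesis
  proof
    show "g = g1 + g2"
      by (rule bcontfun_eqI) (simp add: g1 g2 algebra_simps)
    show "g1 \<in> adm U"
      unfolding adm_def
    proof (intro CollectI conjI exI allI impI)
      show "norm g1 \<le> 1" using g1(2) ng by simp
      show "closedin X (C \<inter> {y \<in> topspace X. 1/3 \<le> k y})"
        using C(1) closed_le by (intro closedin_Int)
      show "C \<inter> {y \<in> topspace X. 1/3 \<le> k y} \<subseteq> U"
        using k(2) by fastforce
      show "\<pi> x \<in> C \<inter> {y \<in> topspace X. 1/3 \<le> k y}" if "apply_bcontfun g1 x \<noteq> 0" for x
        using that C(3)[of x] \<pi>_in by (auto simp: g1 h_def min_def max_def split: if_splits)
    qed
    show "g2 \<in> adm V"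
      unfolding adm_def
    proof (intro CollectI conjI exI allI impI)
      show "norm g2 \<le> 1" using g2(2) ng by simp
      show "closedin X (C \<inter> {y \<in> topspace X. k y \<le> 2/3})"
        using C(1) closed_le by (intro closedin_Int)
      show "C \<inter> {y \<in> topspace X. k y \<le> 2/3} \<subseteq> V"
        using k(3) by fastforce
      show "\<pi> x \<in> C \<inter> {y \<in> topspace X. k y \<le> 2/3}" if "apply_bcontfun g2 x \<noteq> 0" for x
        using that C(3)[of x] \<pi>_in by (auto simp: g2 h_def min_def max_def split: if_splits)
    qed
  qed
qed

lemma var_Un:
  assumes "openin X U" "openin X V"
  shows "var (U \<union> V) \<le> var U + var V"
proof (rule var_least)
  fix g assume "g \<in> adm (U \<union> V)"
  then obtain g1 g2 where g: "g = g1 + g2" "g1 \<in> adm U" "g2 \<in> adm V"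
    using adm_split[OF assms] by blast
  have "ennreal (\<phi> g) \<le> ennreal (\<phi> g1) + ennreal (\<phi> g2)"
    by (simp add: g(1) \<phi>_add ennreal_add_le)
  also have "\<dots> \<le> var U + var V"
    using g by (intro add_mono var_upper)
  finally show "ennreal (\<phi> g) \<le> var U + var V" .
qed

lemma var_finite_Union:
  assumes "finite I" "\<And>i. i \<in> I \<Longrightarrow> openin X (U i)"
  shows "var (\<Union>i\<in>I. U i) \<le> (\<Sum>i\<in>I. var (U i))"
  using assms
proof (induction I rule: finite_induct)
  case (insert i I)
  have "var (\<Union>i\<in>insert i I. U i) \<le> var (U i) + var (\<Union>i\<in>I. U i)"
    using insert by (simp add: var_Un openin_clauses(3) openin_Union)
  also have "\<dots> \<le> (\<Sum>i\<in>insert i I. var (U i))"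
    using insert by (simp add: add_left_mono)
  finally show ?case .
qed (simp add: var_empty)

text \<open>The closed carrier of a test function is compact, so finitely many of the
  \<open>U i\<close> already cover it.\<close>

lemma var_countable_Union:
  assumes "\<And>i :: nat. openin X (U i)"
  shows "var (\<Union>i. U i) \<le> (\<Sum>i. var (U i))"
proof (rule var_least)
  fix g assume "g \<in> adm (\<Union>i. U i)"
  then obtain C where C: "closedin X C" "C \<subseteq> (\<Union>i. U i)" "\<And>x. apply_bcontfun g x \<noteq> 0 \<Longrightarrow> \<pi> x \<in> C" and ng: "norm g \<le> 1"
    by (auto simp: adm_def)
  have "compactin X C"
    using C(1) X(1) by (simp add: closedin_compact_space)
  then obtain \<F> where "finite \<F>" "\<F> \<subseteq> range U" "C \<subseteq> \<Union>\<F>"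
    using C(2) assms unfolding compactin_def by (metis (no_types, lifting) image_iff)
  then obtain I where I: "finite I" "C \<subseteq> (\<Union>i\<in>I. U i)"
    by (metis finite_subset_image)
  have "g \<in> adm (\<Union>i\<in>I. U i)"
    unfolding adm_def using C I(2) ng by blast
  then have "ennreal (\<phi> g) \<le> var (\<Union>i\<in>I. U i)"
    by (rule var_upper)
  also have "\<dots> \<le> (\<Sum>i\<in>I. var (U i))"
    using I(1) assms by (rule var_finite_Union)
  also have "\<dots> \<le> (\<Sum>i. var (U i))"
    by (rule sum_le_suminf) (use I(1) in auto)
  finally show "ennreal (\<phi> g) \<le> (\<Sum>i. var (U i))" .
qed

section \<open>The outer measure induced by the variation\<close>

lemma outer_open: "openin X U \<Longrightarrow> outer U = var U"
  unfolding outer_def by (intro antisym INF_lower INF_greatest) (auto intro: var_mono)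

lemma outer_mono: "E \<subseteq> F \<Longrightarrow> outer E \<le> outer F"
  unfolding outer_def by (rule INF_superset_mono) auto

lemma outer_le_var: "openin X U \<Longrightarrow> E \<subseteq> U \<Longrightarrow> outer E \<le> var U"
  unfolding outer_def by (intro INF_lower) auto

lemma outer_le_1: "E \<subseteq> topspace X \<Longrightarrow> outer E \<le> 1"
  using outer_le_var[of "topspace X" E] by (simp add: var_topspace)

lemma outer_approx:
  assumes "E \<subseteq> topspace X" "e > 0"
  obtains U where "openin X U" "E \<subseteq> U" "var U \<le> outer E + ennreal e"
proof -
  have "outer E < outer E + ennreal e"
    using outer_le_1[OF assms(1)] assms(2)
    by (metis add.right_neutral ennreal_add_left_cancel_less ennreal_less_zero_iff ennreal_one_neq_top
        infinity_ennreal_def top.extremum_uniqueI)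
  then have "\<exists>U\<in>{U. openin X U \<and> E \<subseteq> U}. var U < outer E + ennreal e"
    unfolding outer_def INF_less_iff .
  then show ?thesis
    using that by fastforce
qed

lemma outer_measure_space_outer: "outer_measure_space (Pow (topspace X)) outer"
  unfolding outer_measure_space_def
proof (intro conjI)
  show "positive (Pow (topspace X)) outer"
    by (simp add: positive_def outer_open var_empty)
  show "increasing (Pow (topspace X)) outer"
    by (auto simp: increasing_def outer_mono)
  show "countably_subadditive (Pow (topspace X)) outer"
    unfolding countably_subadditive_def
  proof (intro allI impI)
    fix A :: "nat \<Rightarrow> 'x set" assume A: "range A \<subseteq> Pow (topspace X)"
    show "outer (\<Union>i. A i) \<le> (\<Sum>i. outer (A i))"
    proof (rule ennreal_le_epsilon)
      fix e :: real assume "e > 0"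
      have "\<forall>i. \<exists>U. openin X U \<and> A i \<subseteq> U \<and> var U \<le> outer (A i) + ennreal (e * (1/2) ^ Suc i)"
        using A \<open>e > 0\<close> by (intro allI) (rule outer_approx[of "A i" "e * (1/2) ^ Suc i" for i], auto)
      from choice[OF this] obtain U where U: "\<And>i. openin X (U i)" "\<And>i. A i \<subseteq> U i"
        "\<And>i. var (U i) \<le> outer (A i) + ennreal (e * (1/2) ^ Suc i)"
        by blast
      have "outer (\<Union>i. A i) \<le> var (\<Union>i. U i)"
        using U(1,2) by (intro outer_le_var openin_Union) auto
      also have "\<dots> \<le> (\<Sum>i. var (U i))"
        using U(1) by (rule var_countable_Union)
      also have "\<dots> \<le> (\<Sum>i. outer (A i) + ennreal (e * (1/2) ^ Suc i))"
        using U(3) by (intro suminf_le) auto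
      also have "\<dots> = (\<Sum>i. outer (A i)) + (\<Sum>i. ennreal (e * (1/2) ^ Suc i))"
        by (rule suminf_add[symmetric]) auto
      also have "(\<Sum>i. ennreal (e * (1/2) ^ Suc i)) = ennreal e"
        using \<open>e > 0\<close> sums_mult[OF power_half_series, of e]
        by (intro suminf_ennreal_eq) auto
      finally show "outer (\<Union>i. A i) \<le> (\<Sum>i. outer (A i)) + ennreal e" .
    qed
  qed
qed

text \<open>The Caratheodory inequality for open \<open>V\<close>. If \<open>f\<close> is carried by
  a closed \<open>C\<close> inside \<open>V \<inter> U\<close>, then \<open>V - C\<close> is open
  and contains \<open>V - U\<close>. Functions admissible there vanish where \<open>f\<close> does
  not, so adding them to \<open>f\<close> keeps the norm at most 1 and the values add up.\<close>

lemma var_disjoint: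
  assumes "openin X U" "openin X V"
  shows "var (V \<inter> U) + outer (V - U) \<le> var V"
proof -
  have key: "ennreal (\<phi> f) + ennreal (\<phi> g) \<le> var V"
    if f: "f \<in> adm V" and g: "g \<in> adm V" and C: "\<And>x. apply_bcontfun f x \<noteq> 0 \<Longrightarrow> apply_bcontfun g x = 0" for f g
  proof (cases "\<phi> f \<le> 0 \<or> \<phi> g \<le> 0")
    \<comment> \<open>A value that is not positive contributes 0, so the bound for the other
      function is enough.\<close>
    case True
    then show ?thesis
      using var_upper[OF f] var_upper[OF g] by (auto simp: ennreal_neg)
  next
    case False
    have "f + g \<in> adm V"
    proof -
      obtain C1 C2 where C12: "closedin X C1" "C1 \<subseteq> V" "\<And>x. apply_bcontfun f x \<noteq> 0 \<Longrightarrow> \<pi> x \<in> C1"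
          "closedin X C2" "C2 \<subseteq> V" "\<And>x. apply_bcontfun g x \<noteq> 0 \<Longrightarrow> \<pi> x \<in> C2"
        using f g by (auto simp: adm_def)
      have "norm (f + g) \<le> 1"
      proof (rule norm_bound)
        fix x
        have "\<bar>f x\<bar> \<le> 1" "\<bar>g x\<bar> \<le> 1"
          using f g norm_bounded[of f x] norm_bounded[of g x] by (auto simp: adm_def)
        then show "norm (apply_bcontfun (f + g) x) \<le> 1"
          using C[of x] by (cases "apply_bcontfun f x = 0") auto
      qed
      moreover have "closedin X (C1 \<union> C2)" "C1 \<union> C2 \<subseteq> V"
        using C12 by auto
      moreover have "\<pi> x \<in> C1 \<union> C2" if "apply_bcontfun (f + g) x \<noteq> 0" for x
        using that C12(3,6)[of x] by force
      ultimately show ?thesis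
        unfolding adm_def by blast
    qed
    then have "ennreal (\<phi> f + \<phi> g) \<le> var V"
      using var_upper \<phi>_add by metis
    then show ?thesis
      using False by (simp add: ennreal_plus)
  qed
  have "ennreal (\<phi> f) + outer (V - U) \<le> var V" if f: "f \<in> adm (V \<inter> U)" for f
  proof -
    obtain C where C: "closedin X C" "C \<subseteq> V \<inter> U" "\<And>x. apply_bcontfun f x \<noteq> 0 \<Longrightarrow> \<pi> x \<in> C"
      using f by (auto simp: adm_def)
    have "outer (V - U) \<le> var (V - C)"
      using C assms by (intro outer_le_var openin_diff) auto
    then have "ennreal (\<phi> f) + outer (V - U) \<le> ennreal (\<phi> f) + var (V - C)"
      by (rule add_left_mono)
    also have "\<dots> = (SUP g\<in>adm (V - C). ennreal (\<phi> f) + ennreal (\<phi> g))"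
      unfolding var_def by (rule ennreal_SUP_add_right[OF adm_ne])
    also have "\<dots> \<le> var V"
    proof (rule SUP_least)
      fix g assume g: "g \<in> adm (V - C)"
      show "ennreal (\<phi> f) + ennreal (\<phi> g) \<le> var V"
      proof (rule key)
        show "f \<in> adm V" "g \<in> adm V"
          using f g adm_mono[of "V \<inter> U" V] adm_mono[of "V - C" V] by auto
        show "apply_bcontfun g x = 0" if "apply_bcontfun f x \<noteq> 0" for x
          using C(3)[OF that] g by (auto simp: adm_def)
      qed
    qed
    finally show ?thesis .
  qed
  then have "(SUP f\<in>adm (V \<inter> U). ennreal (\<phi> f) + outer (V - U)) \<le> var V"
    by (rule SUP_least)
  then show ?thesis
    by (simp add: ennreal_SUP_add_left[OF adm_ne] flip: var_def)
qed

section \<open>The regular Borel measure\<close>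

abbreviation "borel_X \<equiv> sigma_sets (topspace X) {U. openin X U}"

text \<open>An open \<open>U\<close> splits every set: \<open>var_disjoint\<close> treats open sets,
  and the infimum over open supersets the others. Hence the Caratheodory \<sigma>-algebra contains
  the Borel sets.\<close>

lemma measure_space_outer: "measure_space (topspace X) borel_X outer"
proof -
  interpret sigma_algebra "topspace X" "Pow (topspace X)"
    by (rule sigma_algebra_Pow)
  let ?L = "lambda_system (topspace X) (Pow (topspace X)) outer"
  have L: "measure_space (topspace X) ?L outer"
    by (rule caratheodory_lemma[OF outer_measure_space_outer])
  have sub: "outer E \<le> outer (E \<inter> U) + outer (E - U)" if "E \<subseteq> topspace X" for E U
  proof -
    have "subadditive (Pow (topspace X)) outer"
      using outer_measure_space_outer
      by (intro countably_subadditive_subadditive) (auto simp: outer_measure_space_def)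
    then have "outer ((E \<inter> U) \<union> (E - U)) \<le> outer (E \<inter> U) + outer (E - U)"
      by (rule subadditiveD) (use that in auto)
    then show ?thesis
      by (simp add: Int_Diff_Un)
  qed
  have "U \<in> ?L" if U: "openin X U" for U
  proof -
    have "outer (E \<inter> U) + outer (E - U) \<le> outer E" if E: "E \<subseteq> topspace X" for E
      unfolding outer_def[of E]
    proof (rule INF_greatest)
      fix V assume V: "V \<in> {V. openin X V \<and> E \<subseteq> V}"
      have "outer (E \<inter> U) + outer (E - U) \<le> var (V \<inter> U) + outer (V - U)"
        using U V by (intro add_mono outer_le_var outer_mono) auto
      also have "\<dots> \<le> var V"
        using U V by (intro var_disjoint) auto
      finally show "outer (E \<inter> U) + outer (E - U) \<le> var V" .
    qed
    then show ?thesis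
      using sub openin_subset[OF U] by (auto simp: lambda_system_eq intro!: antisym)
  qed
  then have "borel_X \<subseteq> ?L"
    using L by (intro sigma_algebra.sigma_sets_subset) (auto simp: measure_space_def)
  then show ?thesis
    using L by (rule measure_down[rotated 2]) (rule sigma_algebra_sigma_sets, auto dest: openin_subset)
qed

definition vmeasure :: "'x measure" where
  "vmeasure = measure_of (topspace X) {U. openin X U} outer"

lemma space_vmeasure: "space vmeasure = topspace X"
  and sets_vmeasure: "sets vmeasure = borel_X"
  unfolding vmeasure_def by (auto dest: openin_subset intro!: space_measure_of sets_measure_of)

lemma emeasure_vmeasure:
  assumes "A \<in> borel_X"
  shows "emeasure vmeasure A = outer A"
  by (rule emeasure_measure_of[OF vmeasure_def])
    (use assms measure_space_outer openin_subset[of X] in \<open>simp_all add: sets_vmeasure measure_space_def subset_iff\<close>)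

lemma open_borel: "openin X U \<Longrightarrow> U \<in> borel_X"
  by auto

lemma borel_subset: "A \<in> borel_X \<Longrightarrow> A \<subseteq> topspace X"
  by (rule sigma_sets_into_sp) (auto dest: openin_subset)

lemma closed_borel:
  assumes "closedin X C" shows "C \<in> borel_X"
proof -
  have "topspace X - (topspace X - C) \<in> borel_X"
    by (rule sigma_sets.Compl[OF open_borel]) (use assms in \<open>simp add: closedin_def\<close>)
  then show ?thesis
    using closedin_subset[OF assms] by (simp add: double_diff)
qed

lemma vmeasure_outer_regular:
  assumes "A \<in> borel_X"
  shows "emeasure vmeasure A = (INF U\<in>{U. openin X U \<and> A \<subseteq> U}. emeasure vmeasure U)"
proof -
  have "(INF U\<in>{U. openin X U \<and> A \<subseteq> U}. emeasure vmeasure U) = outer A"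
    unfolding outer_def by (rule INF_cong) (auto simp: emeasure_vmeasure outer_open)
  then show ?thesis
    by (simp add: emeasure_vmeasure assms)
qed

text \<open>Outer regularity of the complement: if an open \<open>U\<close> exceeds it by at most
  \<open>e\<close>, the complement of \<open>U\<close> is a compact subset of \<open>A\<close>, and
  what it misses of \<open>A\<close> is \<open>A \<inter> U\<close>, of measure at most
  \<open>e\<close>.\<close>

lemma vmeasure_inner_regular:
  assumes A: "A \<in> borel_X"
  shows "emeasure vmeasure A = (SUP C\<in>{C. compactin X C \<and> C \<subseteq> A}. emeasure vmeasure C)"
proof (rule antisym)
  show "(SUP C\<in>{C. compactin X C \<and> C \<subseteq> A}. emeasure vmeasure C) \<le> emeasure vmeasure A"
    using A by (auto intro!: SUP_least emeasure_mono simp: sets_vmeasure)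
  show "emeasure vmeasure A \<le> (SUP C\<in>{C. compactin X C \<and> C \<subseteq> A}. emeasure vmeasure C)"
  proof (rule ennreal_le_epsilon)
    fix e :: real assume "e > 0"
    let ?B = "topspace X - A"
    have B: "?B \<in> borel_X" using A by (rule sigma_sets.Compl)
    obtain U where U: "openin X U" "?B \<subseteq> U" "var U \<le> outer ?B + ennreal e"
      using outer_approx[of ?B e] \<open>e > 0\<close> by auto
    have AU: "A \<inter> U \<in> sets vmeasure" "?B \<in> sets vmeasure" "topspace X - U \<in> sets vmeasure"
      using A B open_borel[OF U(1)] sets.Int[of A vmeasure U] closed_borel[of "topspace X - U"] U(1)
      by (auto simp: sets_vmeasure)
    have "emeasure vmeasure U = emeasure vmeasure (?B \<union> (A \<inter> U))"
      using U(1,2) openin_subset[OF U(1)] by (intro arg_cong[of _ _ "emeasure vmeasure"]) auto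
    also have "\<dots> = emeasure vmeasure ?B + emeasure vmeasure (A \<inter> U)"
      using AU by (intro plus_emeasure[symmetric]) auto
    finally have "outer ?B + emeasure vmeasure (A \<inter> U) \<le> outer ?B + ennreal e"
      using U(1,3) B by (simp add: emeasure_vmeasure outer_open)
    moreover have "outer ?B \<noteq> top"
      using outer_le_1[of ?B] by (auto simp: top_unique)
    ultimately have le: "emeasure vmeasure (A \<inter> U) \<le> ennreal e"
      by (simp add: ennreal_add_left_cancel_le)
    have "emeasure vmeasure A \<le> emeasure vmeasure ((topspace X - U) \<union> (A \<inter> U))"
      using AU borel_subset[OF A] by (intro emeasure_mono) auto
    also have "\<dots> \<le> emeasure vmeasure (topspace X - U) + emeasure vmeasure (A \<inter> U)"
      using AU by (intro emeasure_subadditive)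
    also have "\<dots> \<le> (SUP C\<in>{C. compactin X C \<and> C \<subseteq> A}. emeasure vmeasure C) + ennreal e"
    proof (intro add_mono SUP_upper le)
      show "topspace X - U \<in> {C. compactin X C \<and> C \<subseteq> A}"
        using U X(1) by (auto intro: closedin_compact_space)
    qed
    finally show "emeasure vmeasure A \<le> (SUP C\<in>{C. compactin X C \<and> C \<subseteq> A}. emeasure vmeasure C) + ennreal e" .
  qed
qed

lemma regular_Borel_probability_vmeasure: "regular_Borel_probability X vmeasure"
  unfolding regular_Borel_probability_def
proof (intro conjI ballI)
  show "emeasure vmeasure (space vmeasure) = 1"
    using openin_topspace[of X]
    by (simp add: space_vmeasure emeasure_vmeasure open_borel outer_open var_topspace)
  fix A assume "A \<in> sets vmeasure"
  then have A: "A \<in> borel_X"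
    by (simp add: sets_vmeasure)
  show "emeasure vmeasure A = (SUP C\<in>{C. compactin X C \<and> C \<subseteq> A}. emeasure vmeasure C)"
    by (rule vmeasure_inner_regular[OF A])
  show "emeasure vmeasure A = (INF U\<in>{U. openin X U \<and> A \<subseteq> U}. emeasure vmeasure U)"
    by (rule vmeasure_outer_regular[OF A])
qed (rule space_vmeasure, rule sets_vmeasure)

lemma emeasure_vmeasure_pos:
  assumes "openin X U" "closedin X C" "C \<subseteq> U" "\<phi> g \<noteq> 0" "\<And>x. apply_bcontfun g x \<noteq> 0 \<Longrightarrow> \<pi> x \<in> C"
  shows "emeasure vmeasure U > 0"
proof -
  \<comment> \<open>Scaling brings \<open>g\<close> into the unit ball, and the sign makes the value
    of the functional positive.\<close>
  define h where "h = (sgn (\<phi> g) / norm g) *\<^sub>R g"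
  have "norm g > 0"
    using assms(4) \<phi>_0 by auto
  then have "norm h \<le> 1"
    by (simp add: h_def sgn_if)
  moreover have "\<pi> x \<in> C" if "apply_bcontfun h x \<noteq> 0" for x
    using that assms(5)[of x] by (auto simp: h_def)
  ultimately have "h \<in> adm U"
    using assms(2,3) by (auto simp: adm_def)
  moreover have "\<phi> h > 0"
    using assms(4) \<open>norm g > 0\<close> \<phi> by (auto simp: h_def linear_simps sgn_if field_simps)
  ultimately have "var U > 0"
    using var_upper[of h U] by (metis ennreal_less_zero_iff order_less_le_trans)
  then show ?thesis
    using assms(1) by (simp add: emeasure_vmeasure outer_open)
qed

end

theorem regular_measure_of_functional:
  fixes \<phi> :: "('k::topological_space \<Rightarrow>\<^sub>C real) \<Rightarrow> real" and \<pi> :: "'k \<Rightarrow> 'x"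
  assumes X: "compact_space X" "Hausdorff_space X" and \<pi>: "continuous_map euclidean X \<pi>"
    and \<phi>: "bounded_linear \<phi>" "\<phi> g0 \<noteq> 0"
  obtains M where "regular_Borel_probability X M"
    "\<And>U C g. \<lbrakk>openin X U; closedin X C; C \<subseteq> U; \<phi> g \<noteq> 0; \<And>x. apply_bcontfun g x \<noteq> 0 \<Longrightarrow> \<pi> x \<in> C\<rbrakk> \<Longrightarrow> emeasure M U > 0"
proof -
  \<comment> \<open>\<open>c\<close> is the norm of \<open>\<phi>\<close>. Dividing by it makes the
    variation a probability and does not change where the functional is nonzero.\<close>
  define c where "c = (SUP g\<in>{g. norm g \<le> 1}. ennreal (\<phi> g))"
  obtain K where K: "\<And>g. \<bar>\<phi> g\<bar> \<le> K * norm g" "K > 0"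
    using bounded_linear.pos_bounded[OF \<phi>(1)] by (metis mult.commute real_norm_def)
  have "c \<le> ennreal K"
    unfolding c_def
  proof (rule SUP_least)
    fix g :: "'k \<Rightarrow>\<^sub>C real" assume "g \<in> {g. norm g \<le> 1}"
    then have "K * norm g \<le> K * 1"
      using K(2) by (intro mult_left_mono) auto
    then show "ennreal (\<phi> g) \<le> ennreal K"
      using K(1)[of g] by (intro ennreal_leI) linarith
  qed
  then have c_top: "c \<noteq> top"
    by (auto simp: top_unique)
  define g1 where "g1 = (sgn (\<phi> g0) / norm g0) *\<^sub>R g0"
  have g0: "norm g0 > 0"
    using \<phi> by (auto simp: linear_simps)
  then have "norm g1 \<le> 1" "\<phi> g1 > 0"
    using \<phi> by (auto simp: g1_def linear_simps sgn_if field_simps)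
  then have "0 < ennreal (\<phi> g1)" "ennreal (\<phi> g1) \<le> c"
    unfolding c_def by (auto intro: SUP_upper)
  then have c_pos: "c > 0"
    by (rule order_less_le_trans)
  define r where "r = enn2real c"
  have r: "r > 0" "c = ennreal r"
    using c_pos c_top by (auto simp: r_def enn2real_positive_iff less_top)
  interpret variation X \<pi> "\<lambda>g. \<phi> g / r"
  proof (intro variation.intro X \<pi>)
    show "bounded_linear (\<lambda>g. \<phi> g / r)"
      using bounded_linear_compose[OF bounded_linear_divide \<phi>(1)] .
    have "(SUP g\<in>{g. norm g \<le> 1}. ennreal (\<phi> g / r)) = (SUP g\<in>{g. norm g \<le> 1}. ennreal (1 / r) * ennreal (\<phi> g))"
      using r(1) by (intro SUP_cong refl) (simp flip: ennreal_mult')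
    also have "\<dots> = ennreal (1 / r) * c"
      unfolding c_def by (rule SUP_mult_left_ennreal[symmetric])
    also have "\<dots> = 1"
      using r by (simp flip: ennreal_mult')
    finally show "(SUP g\<in>{g. norm g \<le> 1}. ennreal (\<phi> g / r)) = 1" .
  qed
  show ?thesis
    using that[OF regular_Borel_probability_vmeasure] emeasure_vmeasure_pos r(1) by force
qed

subsection \<open>Extension of functionals\<close>

definition sublinear :: "('b::real_vector \<Rightarrow> real) \<Rightarrow> bool" where
  "sublinear q \<longleftrightarrow> (\<forall>x y. q (x + y) \<le> q x + q y) \<and> (\<forall>t\<ge>0. \<forall>x. q (t *\<^sub>R x) \<le> t * q x)"

lemma sublinear_zero: "sublinear q \<Longrightarrow> q 0 = 0"
  unfolding sublinear_def by (metis add.right_neutral le_add_same_cancel2 mult_zero_left order_antisym order_refl scaleR_zero_left)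

lemma sublinear_minus_le:
  assumes "sublinear q" shows "- q (- x) \<le> q x"
proof -
  have "q (x + - x) \<le> q x + q (- x)"
    using assms unfolding sublinear_def by blast
  then show ?thesis
    using sublinear_zero[OF assms] by simp
qed

lemma sublinear_scaleR:
  assumes "sublinear q" "t \<ge> 0" shows "q (t *\<^sub>R x) = t * q x"
proof (cases "t = 0")
  case False
  have "q ((1 / t) *\<^sub>R (t *\<^sub>R x)) \<le> (1 / t) * q (t *\<^sub>R x)"
    using assms unfolding sublinear_def by (metis divide_nonneg_nonneg zero_le_one)
  then have "t * q x \<le> q (t *\<^sub>R x)"
    using assms(2) False by (simp add: field_simps)
  then show ?thesis
    using assms unfolding sublinear_def by (simp add: order_antisym)
qed (simp add: sublinear_zero[OF assms(1)])

text \<open>One criterion for three infima: over a half-line for minimality, over a chain for Zorn's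
  lemma, and over the domain of \<open>T\<close> for the extension. The lower bound \<open>l\<close>
  keeps the infimum a genuine one.\<close>

lemma sublinear_INF:
  fixes f :: "'i \<Rightarrow> 'b::real_vector \<Rightarrow> real"
  assumes ne: "I \<noteq> {}" and bdd: "\<And>x i. i \<in> I \<Longrightarrow> l x \<le> f i x"
    and add: "\<And>x y i j. i \<in> I \<Longrightarrow> j \<in> I \<Longrightarrow> \<exists>k\<in>I. f k (x + y) \<le> f i x + f j y"
    and scale: "\<And>t x i. i \<in> I \<Longrightarrow> t \<ge> 0 \<Longrightarrow> \<exists>k\<in>I. f k (t *\<^sub>R x) \<le> t * f i x"
  shows "sublinear (\<lambda>x. INF i\<in>I. f i x)"
proof -
  have lower: "(INF i\<in>I. f i x) \<le> f i x" if "i \<in> I" for i x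
    using that bdd by (intro cINF_lower bdd_belowI2[where m = "l x"]) auto
  have "(INF i\<in>I. f i (x + y)) \<le> (INF i\<in>I. f i x) + (INF i\<in>I. f i y)" for x y
  proof -
    have le: "(INF i\<in>I. f i (x + y)) - f i x \<le> f j y" if ij: "i \<in> I" "j \<in> I" for i j
    proof -
      obtain k where "k \<in> I" "f k (x + y) \<le> f i x + f j y"
        using add[OF ij] by blast
      then show ?thesis
        using lower[of k "x + y"] by linarith
    qed
    have "(INF i\<in>I. f i (x + y)) - f i x \<le> (INF j\<in>I. f j y)" if "i \<in> I" for i
      by (rule cINF_greatest[OF ne le[OF that]])
    then have "(INF i\<in>I. f i (x + y)) - (INF j\<in>I. f j y) \<le> (INF i\<in>I. f i x)"
      using ne by (intro cINF_greatest) (simp_all add: algebra_simps)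
    then show ?thesis by simp
  qed
  moreover have "(INF i\<in>I. f i (t *\<^sub>R x)) \<le> t * (INF i\<in>I. f i x)" if "t \<ge> 0" for t x
  proof -
    have le: "(INF i\<in>I. f i (t *\<^sub>R x)) \<le> t * f i x" if "i \<in> I" for i
      using scale[OF that \<open>t \<ge> 0\<close>, of x] lower order_trans by blast
    show ?thesis
    proof (cases "t = 0")
      case True
      then show ?thesis using le ne by auto
    next
      case False
      then have "(INF i\<in>I. f i (t *\<^sub>R x)) / t \<le> (INF i\<in>I. f i x)"
        using ne le that by (intro cINF_greatest) (auto simp: field_simps)
      then show ?thesis
        using False that by (simp add: field_simps)
    qed
  qed
  ultimately show ?thesis
    unfolding sublinear_def by blast
qed

text \<open>For fixed \<open>a\<close>, the infimum over t \<ge> 0 of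
  \<open>q (v + t *\<^sub>R a) - t * q a\<close> is sublinear and lies below \<open>q\<close>. By
  minimality it equals \<open>q\<close>, and t = 1 gives superadditivity.\<close>

lemma minimal_sublinear_linear:
  assumes q: "sublinear q" and min: "\<And>q'. sublinear q' \<Longrightarrow> q' \<le> q \<Longrightarrow> q' = q"
  shows "linear q"
proof -
  have sub: "q (x + y) \<le> q x + q y" for x y
    using q unfolding sublinear_def by blast
  have sup: "q v + q a \<le> q (v + a)" for v a
  proof -
    define q' where "q' v = (INF t\<in>{0..}. q (v + t *\<^sub>R a) - t * q a)" for v
    have lower: "- q (- v) \<le> q (v + t *\<^sub>R a) - t * q a" if "t \<ge> 0" for v t
      using sub[of "v + t *\<^sub>R a" "- v"] sublinear_scaleR[OF q that, of a] by simp
    have q'_le: "q' v \<le> q (v + t *\<^sub>R a) - t * q a" if "t \<ge> 0" for v t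
      unfolding q'_def using that lower
      by (intro cINF_lower bdd_belowI2[where m = "- q (- v)"]) auto
    have "sublinear q'"
      unfolding q'_def
    proof (rule sublinear_INF)
      show "- q (- x) \<le> q (x + t *\<^sub>R a) - t * q a" if "t \<in> {0..}" for x t
        using lower that by simp
      show "\<exists>k\<in>{0..}. q (x + y + k *\<^sub>R a) - k * q a \<le> q (x + i *\<^sub>R a) - i * q a + (q (y + j *\<^sub>R a) - j * q a)"
        if "i \<in> {0..}" "j \<in> {0..}" for x y and i j :: real
        using that sub[of "x + i *\<^sub>R a" "y + j *\<^sub>R a"]
        by (intro bexI[of _ "i + j"]) (auto simp: algebra_simps)
      show "\<exists>k\<in>{0..}. q (t *\<^sub>R x + k *\<^sub>R a) - k * q a \<le> t * (q (x + i *\<^sub>R a) - i * q a)"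
        if "i \<in> {0..}" "t \<ge> 0" for x and i t :: real
        using that sublinear_scaleR[OF q that(2), of "x + i *\<^sub>R a"]
        by (intro bexI[of _ "t * i"]) (auto simp: algebra_simps)
    qed simp
    moreover have "q' \<le> q"
      using q'_le[of 0] by (auto simp: le_fun_def)
    ultimately have "q' = q"
      by (rule min)
    then show ?thesis
      using q'_le[of 1 v] by simp
  qed
  have add: "q (x + y) = q x + q y" for x y
    using sub sup by (rule antisym)
  have neg: "q (- x) = - q x" for x
    using add[of x "- x"] sublinear_zero[OF q] by simp
  have "q (t *\<^sub>R x) = t * q x" for t x
    using sublinear_scaleR[OF q, of t x] sublinear_scaleR[OF q, of "- t" x] neg[of "t *\<^sub>R x"]
    by (cases "t \<ge> 0") auto
  with add show ?thesis
    by (intro linearI) auto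
qed

text \<open>Hahn-Banach by Zorn's lemma applied downwards to everywhere defined sublinear
  functionals. No partial functionals occur; a chain has its pointwise infimum as lower bound,
  finite because every member is at least \<open>- p (- x)\<close>.\<close>

theorem sublinear_dominates_linear:
  assumes p: "sublinear p"
  obtains q where "linear q" "\<And>x. q x \<le> p x"
proof -
  define S where "S = {q. sublinear q \<and> q \<le> p}"
  have "\<exists>m\<in>S. \<forall>a\<in>S. a \<le> m \<longrightarrow> a = m"
  proof (rule predicate_Zorn)
    show "partial_order_on S (relation_of (\<lambda>x y. y \<le> x) S)"
      by (rule partial_order_on_relation_ofI) auto
    fix C assume "C \<in> Chains (relation_of (\<lambda>x y. y \<le> x) S)"
    then have CS: "C \<subseteq> S" and chain: "\<And>a b. a \<in> C \<Longrightarrow> b \<in> C \<Longrightarrow> a \<le> b \<or> b \<le> a"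
      by (auto simp: Chains_def relation_of_def)
    show "\<exists>u\<in>S. \<forall>a\<in>C. u \<le> a"
    proof (cases "C = {}")
      case True
      then show ?thesis
        using p by (auto simp: S_def)
    next
      case False
      define u where "u x = (INF q\<in>C. q x)" for x
      have lower: "- p (- x) \<le> q x" if "q \<in> C" for q x
      proof -
        have "sublinear q" "q (- x) \<le> p (- x)"
          using that CS by (auto simp: S_def le_fun_def)
        then show ?thesis
          using sublinear_minus_le[of q x] by linarith
      qed
      have le: "u x \<le> q x" if "q \<in> C" for q x
        unfolding u_def using that lower by (intro cINF_lower bdd_belowI2[where m = "- p (- x)"]) auto
      have "sublinear u"
        unfolding u_def
      proof (rule sublinear_INF[OF False])
        show "- p (- x) \<le> q x" if "q \<in> C" for q x
          by (rule lower[OF that])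
        show "\<exists>k\<in>C. k (x + y) \<le> i x + j y" if ij: "i \<in> C" "j \<in> C" for x y i j
        proof -
          obtain k where k: "k \<in> C" "k \<le> i" "k \<le> j"
            using chain[OF ij] ij by blast
          then have "k (x + y) \<le> k x + k y" "k x \<le> i x" "k y \<le> j y"
            using CS by (auto simp: S_def sublinear_def le_fun_def)
          then show ?thesis
            using k(1) by (intro bexI[of _ k]) auto
        qed
        show "\<exists>k\<in>C. k (t *\<^sub>R x) \<le> t * i x" if "i \<in> C" "t \<ge> 0" for t x i
          using that CS by (auto simp: S_def sublinear_def intro!: bexI[of _ i])
      qed
      moreover have "u \<le> p"
      proof (rule le_funI)
        fix x
        obtain q where "q \<in> C" using False by blast
        then show "u x \<le> p x"
          using le[of q x] CS by (auto simp: S_def le_fun_def intro: order_trans)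
      qed
      ultimately show ?thesis
        using le by (intro bexI[of _ u]) (auto simp: S_def le_fun_def)
    qed
  qed
  then obtain m where m: "m \<in> S" "\<And>a. a \<in> S \<Longrightarrow> a \<le> m \<Longrightarrow> a = m"
    by blast
  show ?thesis
  proof
    show "linear m"
    proof (rule minimal_sublinear_linear)
      show "q' = m" if "sublinear q'" "q' \<le> m" for q'
        using that m by (auto simp: S_def intro: order_trans)
    qed (use m(1) in \<open>simp add: S_def\<close>)
    show "m x \<le> p x" for x
      using m(1) by (simp add: S_def le_fun_def)
  qed
qed

text \<open>The auxiliary \<open>p\<close> encodes both requirements. For a linear functional below
  \<open>p\<close>, the choice g = 0 gives the norm bound 1/c, and v = T g gives agreement with
  \<open>\<psi>\<close> on the range of \<open>T\<close>. The estimate from below for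
  \<open>T\<close> makes \<open>p\<close> finite.\<close>

theorem functional_extension_embedding:
  fixes T :: "'a::real_normed_vector \<Rightarrow> 'b::real_normed_vector"
  assumes T: "linear T" "c > 0" "\<And>g. c * norm g \<le> norm (T g)"
    and \<psi>: "linear \<psi>" "\<And>g. \<bar>\<psi> g\<bar> \<le> norm g"
  obtains \<phi> where "linear \<phi>" "\<And>v. \<bar>\<phi> v\<bar> \<le> norm v / c" "\<And>g. \<phi> (T g) = \<psi> g"
proof -
  define p where "p v = (INF g. norm (v - T g) / c + \<psi> g)" for v
  have lower: "- (norm v / c) \<le> norm (v - T g) / c + \<psi> g" for v g
  proof -
    have "c * norm g \<le> norm (v - T g) + norm v"
      using T(3)[of g] norm_triangle_ineq[of "T g - v" v] by (simp add: norm_minus_commute)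
    then have "norm g \<le> norm (v - T g) / c + norm v / c"
      using T(2) by (simp add: field_simps)
    then show ?thesis
      using \<psi>(2)[of g] by linarith
  qed
  have p_le: "p v \<le> norm (v - T g) / c + \<psi> g" for v g
    unfolding p_def using lower by (intro cINF_lower bdd_belowI2[where m = "- (norm v / c)"]) auto
  have "sublinear p"
    unfolding p_def
  proof (rule sublinear_INF)
    show "- (norm x / c) \<le> norm (x - T g) / c + \<psi> g" for x g
      by (rule lower)
    fix x y g h
    have "norm (x + y - T (g + h)) \<le> norm (x - T g) + norm (y - T h)"
      using norm_triangle_ineq[of "x - T g" "y - T h"] by (simp add: linear_add[OF T(1)] algebra_simps)
    then have "norm (x + y - T (g + h)) / c \<le> norm (x - T g) / c + norm (y - T h) / c"
      using T(2) by (simp add: divide_right_mono flip: add_divide_distrib)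
    then show "\<exists>k\<in>UNIV. norm (x + y - T k) / c + \<psi> k \<le> norm (x - T g) / c + \<psi> g + (norm (y - T h) / c + \<psi> h)"
      by (intro bexI[of _ "g + h"]) (simp_all add: linear_add[OF \<psi>(1)])
  next
    fix t :: real and x g assume "t \<ge> 0"
    then have "norm (t *\<^sub>R x - T (t *\<^sub>R g)) = t * norm (x - T g)"
      by (simp add: linear_scale[OF T(1)] flip: scaleR_diff_right)
    then show "\<exists>k\<in>UNIV. norm (t *\<^sub>R x - T k) / c + \<psi> k \<le> t * (norm (x - T g) / c + \<psi> g)"
      by (intro bexI[of _ "t *\<^sub>R g"]) (simp_all add: linear_scale[OF \<psi>(1)] algebra_simps)
  qed simp
  then obtain \<phi> where \<phi>: "linear \<phi>" "\<And>v. \<phi> v \<le> p v"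
    by (rule sublinear_dominates_linear) blast
  have le_norm: "\<phi> v \<le> norm v / c" for v
    using \<phi>(2)[of v] p_le[of v 0] by (simp add: linear_0[OF T(1)] linear_0[OF \<psi>(1)])
  have le_\<psi>: "\<phi> (T g) \<le> \<psi> g" for g
    using \<phi>(2)[of "T g"] p_le[of "T g" g] by simp
  show ?thesis
  proof
    show "\<bar>\<phi> v\<bar> \<le> norm v / c" for v
      using le_norm[of v] le_norm[of "- v"] by (simp add: linear_neg[OF \<phi>(1)])
    show "\<phi> (T g) = \<psi> g" for g
      using le_\<psi>[of g] le_\<psi>[of "- g"]
      by (simp add: linear_neg[OF \<phi>(1)] linear_neg[OF \<psi>(1)] linear_neg[OF T(1)])
  qed (rule \<phi>(1))
qed

subsection \<open>Calibers and supports of functionals\<close>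

lemma bcontfun_of_continuous:
  fixes u :: "'k::topological_space \<Rightarrow> real"
  assumes "compact (UNIV :: 'k set)" "continuous_on UNIV u"
  shows "apply_bcontfun (Bcontfun u) = u"
proof -
  have "bounded (range u)"
    using assms by (intro compact_imp_bounded compact_continuous_image)
  then show ?thesis
    using assms(2) by (simp add: Bcontfun_inverse bcontfun_def)
qed

lemma compact_imp_closedin_top_of_set:
  assumes "Hausdorff_space (euclidean :: 'x::topological_space topology)" "compact C" "C \<subseteq> (S :: 'x set)"
  shows "closedin (top_of_set S) C"
  using assms compactin_imp_closedin[of euclidean C] by (simp add: closedin_subset_trans closed_subset)

lemma not_small_injection:
  assumes "Card_order \<kappa>" "\<not> |N| <o \<kappa>"
  obtains j where "inj_on j (Field \<kappa>)" "j ` Field \<kappa> \<subseteq> N"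
proof -
  have "\<kappa> \<le>o |N|"
    using assms ordLess_or_ordLeq[OF card_of_Well_order, of \<kappa> N] by (auto simp: card_order_on_def)
  then have "|Field \<kappa>| \<le>o |N|"
    using assms(1) card_of_Field_ordIso ordIso_ordLeq_trans by blast
  then show ?thesis
    using that by (auto simp flip: card_of_ordLeq)
qed

text \<open>Integration against mass \<open>(1/2) ^ n\<close> at each \<open>n\<close>, on the
  bounded functions on the discrete space of natural numbers; the geometric series yields the bound
  2.\<close>

lemma bounded_linear_weighted_series:
  "bounded_linear (\<lambda>g :: nat \<Rightarrow>\<^sub>C real. \<Sum>n. (1/2) ^ n * g n)"
proof -
  have geo: "summable (\<lambda>n. (1/2 :: real) ^ n)"
    by (simp add: summable_geometric)
  have le: "norm ((1/2) ^ n * g n) \<le> (1/2) ^ n * norm g" for g :: "nat \<Rightarrow>\<^sub>C real" and n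
    using norm_bounded[of g n] by (simp add: abs_mult)
  have summ: "summable (\<lambda>n. norm ((1/2) ^ n * g n))" for g :: "nat \<Rightarrow>\<^sub>C real"
    by (rule summable_comparison_test'[OF summable_mult2[OF geo, of "norm g"], of 0]) (use le in simp)
  note summ' = summable_norm_cancel[OF summ]
  show ?thesis
  proof (rule bounded_linear_intro)
    fix g h :: "nat \<Rightarrow>\<^sub>C real" and r :: real
    show "(\<Sum>n. (1/2) ^ n * (g + h) n) = (\<Sum>n. (1/2) ^ n * g n) + (\<Sum>n. (1/2) ^ n * h n)"
      using suminf_add[OF summ' summ', of g h] by (simp add: algebra_simps)
    show "(\<Sum>n. (1/2) ^ n * (r *\<^sub>R g) n) = r *\<^sub>R (\<Sum>n. (1/2) ^ n * g n)"
      using suminf_mult[OF summ', of r g] by (simp add: algebra_simps)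
    have "norm (\<Sum>n. (1/2) ^ n * g n) \<le> (\<Sum>n. norm ((1/2) ^ n * g n))"
      by (rule summable_norm[OF summ])
    also have "\<dots> \<le> (\<Sum>n. (1/2) ^ n * norm g)"
      by (rule suminf_le[OF le summ summable_mult2[OF geo]])
    also have "\<dots> = norm g * 2"
      using suminf_mult2[OF geo, of "norm g"] by (simp add: suminf_geometric)
    finally show "norm (\<Sum>n. (1/2) ^ n * g n) \<le> norm g * 2" .
  qed
qed

text \<open>A measure charging every point \<open>1 / (n + 1)\<close> of a convergent sequence shows that \<open>\<omega>\<close> is no caliber: each
  point of the sequence lies in only finitely many of the intervals \<open>(0, 1 / (n + 1))\<close>.\<close>

theorem caliber_uncountable:
  fixes \<kappa> :: "'c rel"
  assumes "Cinfinite \<kappa>" "caliber_of_Radon_measures \<kappa>"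
  shows "natLeq <o \<kappa>"
proof (rule ccontr)
  assume "\<not> natLeq <o \<kappa>"
  then have "\<kappa> \<le>o natLeq"
    using ordLess_or_ordLeq[OF natLeq_Well_order, of \<kappa>] assms(1) by (auto simp: card_order_on_def)
  then have "|Field \<kappa>| \<le>o |UNIV :: nat set|"
    using assms(1) card_of_Field_ordIso card_of_nat
    by (meson ordIso_ordLeq_trans ordIso_symmetric ordLeq_ordIso_trans)
  then obtain j :: "'c \<Rightarrow> nat" where j: "inj_on j (Field \<kappa>)"
    by (auto simp flip: card_of_ordLeq)
  \<comment> \<open>Test spaces have their points in \<open>'c \<Rightarrow> real\<close>, so the
    sequence is placed on the diagonal there; \<open>undefined\<close> is merely some coordinate at
    which its value is read off.\<close>
  define k where "k = (\<lambda>(t::real) (_::'c). t)"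
  define c where "c n = k (1 / real (Suc n))" for n
  define S where "S = k ` insert 0 (range (\<lambda>n. 1 / real (Suc n)))"
  define A where "A \<alpha> = {y \<in> S. 0 < y undefined \<and> y undefined < 1 / real (Suc (j \<alpha>))}" for \<alpha>
  have ck: "continuous_on T k" for T
    unfolding k_def by (intro continuous_on_coordinatewise_then_product continuous_on_id)
  have "compact S"
    unfolding S_def using LIMSEQ_inverse_real_of_nat
    by (intro compact_continuous_image ck compact_sequence_with_limit) (simp add: inverse_eq_divide)
  have cS: "c n \<in> S" for n
    by (simp add: c_def S_def)
  have "open {y :: 'c \<Rightarrow> real. 0 < y undefined}" "open {y :: 'c \<Rightarrow> real. y undefined < 1 / real (Suc (j \<alpha>))}" for \<alpha>
    by (intro open_Collect_less continuous_on_const continuous_on_product_coordinates)+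
  then have "open ({y :: 'c \<Rightarrow> real. 0 < y undefined} \<inter> {y. y undefined < 1 / real (Suc (j \<alpha>))})" for \<alpha>
    by (rule open_Int)
  moreover have "A \<alpha> = S \<inter> ({y. 0 < y undefined} \<inter> {y. y undefined < 1 / real (Suc (j \<alpha>))})" for \<alpha>
    by (auto simp: A_def)
  ultimately have openA: "openin (top_of_set S) (A \<alpha>)" for \<alpha>
    by (metis openin_open_Int)
  have ind: "(\<lambda>m. if m = n then 1 else 0) \<in> bcontfun" for n :: nat
    unfolding bcontfun_def
    by (auto simp: continuous_on_discrete intro!: bounded_subset[OF finite_imp_bounded[of "{0, 1}"]])
  let ?\<phi> = "\<lambda>g :: nat \<Rightarrow>\<^sub>C real. \<Sum>n. (1/2) ^ n * g n"
  define \<delta> where "\<delta> n = Bcontfun (\<lambda>m :: nat. if m = n then 1 else 0 :: real)" for n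
  have \<delta>: "apply_bcontfun (\<delta> n) m = (if m = n then 1 else 0)" for n m
    by (simp add: \<delta>_def Bcontfun_inverse[OF ind])
  have \<phi>\<delta>: "?\<phi> (\<delta> n) \<noteq> 0" for n
  proof -
    have "(\<Sum>m. (1/2) ^ m * apply_bcontfun (\<delta> n) m) = (\<Sum>m\<in>{n}. (1/2) ^ m * apply_bcontfun (\<delta> n) m)"
      by (rule suminf_finite) (auto simp: \<delta>)
    then show ?thesis
      by (simp add: \<delta>)
  qed
  have X: "compact_space (top_of_set S)" "Hausdorff_space (top_of_set S)"
    using \<open>compact S\<close> by (simp_all add: compact_space_subtopology Hausdorff_space_subtopology Hausdorff_space_euclidean_fun)
  obtain M where M: "regular_Borel_probability (top_of_set S) M"
    "\<And>U C g. \<lbrakk>openin (top_of_set S) U; closedin (top_of_set S) C; C \<subseteq> U; ?\<phi> g \<noteq> 0;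
      \<And>x. apply_bcontfun g x \<noteq> 0 \<Longrightarrow> c x \<in> C\<rbrakk> \<Longrightarrow> emeasure M U > 0"
  proof (rule regular_measure_of_functional[OF X _ bounded_linear_weighted_series \<phi>\<delta>])
    show "continuous_map euclidean (top_of_set S) c"
      using cS by (auto simp: continuous_map_in_subtopology continuous_on_discrete)
  qed blast
  have "emeasure M (A \<alpha>) > 0" for \<alpha>
  proof (rule M(2)[OF openA _ _ \<phi>\<delta>])
    \<comment> \<open>The successor matters: the point with index \<open>j \<alpha>\<close> is the
      excluded right end of the interval, the next one lies inside.\<close>
    show "closedin (top_of_set S) {c (Suc (j \<alpha>))}"
      using cS by (intro compact_imp_closedin_top_of_set Hausdorff_space_euclidean_fun) auto
    show "{c (Suc (j \<alpha>))} \<subseteq> A \<alpha>"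
      using cS by (auto simp: A_def) (auto simp: c_def k_def divide_simps)
    show "c x \<in> {c (Suc (j \<alpha>))}" if "apply_bcontfun (\<delta> (Suc (j \<alpha>))) x \<noteq> 0" for x
      using that by (simp add: \<delta> split: if_splits)
  qed
  moreover have "A \<alpha> \<in> sets M" for \<alpha>
    using M(1) openA by (auto simp: regular_Borel_probability_def)
  ultimately have "\<exists>y\<in>topspace (top_of_set S). |{\<alpha> \<in> Field \<kappa>. y \<in> A \<alpha>}| =o \<kappa>"
    by (intro assms(2)[unfolded caliber_of_Radon_measures_def, rule_format, OF X M(1)]) simp
  then obtain y where y: "y \<in> S" "|{\<alpha> \<in> Field \<kappa>. y \<in> A \<alpha>}| =o \<kappa>"
    by auto
  have "finite {\<alpha> \<in> Field \<kappa>. y \<in> A \<alpha>}"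
  proof (cases "y = k 0")
    case True
    then have "{\<alpha> \<in> Field \<kappa>. y \<in> A \<alpha>} = {}"
      by (auto simp: A_def k_def)
    then show ?thesis
      by (metis finite.emptyI)
  next
    case False
    then obtain n where n: "y = c n"
      using y(1) by (auto simp: S_def c_def)
    have "j ` {\<alpha> \<in> Field \<kappa>. y \<in> A \<alpha>} \<subseteq> {..<n}"
      unfolding n by (auto simp: A_def c_def k_def divide_simps)
    then have "finite (j ` {\<alpha> \<in> Field \<kappa>. y \<in> A \<alpha>})"
      by (rule finite_subset) simp
    then show ?thesis
      by (rule finite_imageD) (rule inj_on_subset[OF j], blast)
  qed
  moreover have "Cinfinite |{\<alpha> \<in> Field \<kappa>. y \<in> A \<alpha>}|"
    by (rule Cinfinite_cong[OF ordIso_symmetric[OF y(2)] assms(1)])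
  ultimately show False
    by (simp add: cinfinite_def Field_card_of)
qed

text \<open>Positive variation of the set where a coordinate is nonzero is expressed by a function
  \<open>d\<close> that vanishes off this set and is not annihilated by \<open>\<phi>\<close>.
  Monomials containing the coordinate are of this kind.\<close>

lemma small_functional_support:
  fixes \<kappa> :: "'c rel" and e :: "'k::t2_space \<Rightarrow> 'g \<Rightarrow> real" and \<phi> :: "('k \<Rightarrow>\<^sub>C real) \<Rightarrow> real"
  assumes \<kappa>: "Cinfinite \<kappa>" "caliber_of_Radon_measures \<kappa>" and K: "compact (UNIV :: 'k set)"
    and e: "\<And>\<gamma>. \<gamma> \<in> \<Gamma> \<Longrightarrow> continuous_on UNIV (\<lambda>x. e x \<gamma>)" "\<And>x. |{\<gamma> \<in> \<Gamma>. e x \<gamma> \<noteq> 0}| <o \<kappa>"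
    and \<phi>: "bounded_linear \<phi>"
  shows "|{\<gamma> \<in> \<Gamma>. \<exists>d. \<phi> d \<noteq> 0 \<and> (\<forall>x. apply_bcontfun d x \<noteq> 0 \<longrightarrow> e x \<gamma> \<noteq> 0)}| <o \<kappa>"
    (is "|?N| <o \<kappa>")
proof (rule ccontr)
  assume "\<not> |?N| <o \<kappa>"
  then obtain j where j: "inj_on j (Field \<kappa>)" "j ` Field \<kappa> \<subseteq> ?N"
    using \<kappa>(1) by (blast intro: not_small_injection)
  \<comment> \<open>Reindexing by \<open>\<kappa>\<close> puts the image into the type of the test
    spaces. Coordinates outside the index set are frozen at 0.\<close>
  define \<pi> where "\<pi> x = (\<lambda>\<alpha>. if \<alpha> \<in> Field \<kappa> then e x (j \<alpha>) else 0)" for x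
  define S where "S = range \<pi>"
  define A where "A \<alpha> = {y \<in> S. y \<alpha> \<noteq> 0}" for \<alpha>
  have c\<pi>: "continuous_on T \<pi>" for T
  proof -
    have "continuous_on T (\<lambda>x. \<pi> x \<alpha>)" for \<alpha>
      using e(1) j(2) by (cases "\<alpha> \<in> Field \<kappa>") (auto simp: \<pi>_def intro: continuous_on_subset)
    then show ?thesis
      by (rule continuous_on_coordinatewise_then_product)
  qed
  have "compact S"
    unfolding S_def by (rule compact_continuous_image[OF c\<pi> K])
  then have X: "compact_space (top_of_set S)" "Hausdorff_space (top_of_set S)"
    by (simp_all add: compact_space_subtopology Hausdorff_space_subtopology Hausdorff_space_euclidean_fun)
  have "Field \<kappa> \<noteq> {}"
    using \<kappa>(1) by (auto simp: cinfinite_def)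
  then obtain d0 where d0: "\<phi> d0 \<noteq> 0"
    using j(2) by blast
  have "open {y :: 'c \<Rightarrow> real. y \<alpha> \<noteq> 0}" for \<alpha>
    by (intro open_Collect_neq continuous_on_const continuous_on_product_coordinates)
  moreover have "A \<alpha> = S \<inter> {y. y \<alpha> \<noteq> 0}" for \<alpha>
    by (auto simp: A_def)
  ultimately have openA: "openin (top_of_set S) (A \<alpha>)" for \<alpha>
    by (metis openin_open_Int)
  obtain M where M: "regular_Borel_probability (top_of_set S) M"
    "\<And>U C g. \<lbrakk>openin (top_of_set S) U; closedin (top_of_set S) C; C \<subseteq> U; \<phi> g \<noteq> 0;
      \<And>x. apply_bcontfun g x \<noteq> 0 \<Longrightarrow> \<pi> x \<in> C\<rbrakk> \<Longrightarrow> emeasure M U > 0"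
  proof (rule regular_measure_of_functional[OF X _ \<phi> d0])
    show "continuous_map euclidean (top_of_set S) \<pi>"
      using c\<pi> by (auto simp: S_def continuous_map_in_subtopology)
  qed blast
  obtain B where B: "\<And>g. \<bar>\<phi> g\<bar> \<le> B * norm g" "B > 0"
    using bounded_linear.pos_bounded[OF \<phi>] by (metis mult.commute real_norm_def)
  have "emeasure M (A \<alpha>) > 0" if \<alpha>: "\<alpha> \<in> Field \<kappa>" for \<alpha>
  proof -
    obtain d where d: "\<phi> d \<noteq> 0" "\<And>x. apply_bcontfun d x \<noteq> 0 \<Longrightarrow> e x (j \<alpha>) \<noteq> 0"
      using j(2) \<alpha> by blast
    \<comment> \<open>\<open>d\<close> need not be carried by a closed part of
      \<open>A \<alpha>\<close>, but \<open>d - t\<close>, with \<open>t\<close> the truncation of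
      \<open>d\<close> at height \<open>\<epsilon>\<close>, vanishes where the modulus of
      \<open>d\<close> is below \<open>\<epsilon>\<close>. Half of the critical height is taken so
      that \<open>\<phi> t\<close> is too small to cancel \<open>\<phi> d\<close>.\<close>
    define \<epsilon> where "\<epsilon> = \<bar>\<phi> d\<bar> / (2 * B)"
    have \<epsilon>: "\<epsilon> > 0" "B * \<epsilon> < \<bar>\<phi> d\<bar>"
      using d(1) B(2) by (auto simp: \<epsilon>_def field_simps)
    define t where "t = Bcontfun (\<lambda>x. max (- \<epsilon>) (min \<epsilon> (apply_bcontfun d x)))"
    have t: "apply_bcontfun t x = max (- \<epsilon>) (min \<epsilon> (apply_bcontfun d x))" for x
      unfolding t_def by (subst bcontfun_of_continuous[OF K]) (auto intro!: continuous_intros)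
    have "norm t \<le> \<epsilon>"
      by (rule norm_bound) (use \<epsilon>(1) in \<open>auto simp: t\<close>)
    then have "\<bar>\<phi> t\<bar> \<le> B * \<epsilon>"
      using B(1)[of t] B(2) by (meson mult_left_mono order_trans less_imp_le)
    then have "\<phi> (d - t) \<noteq> 0"
      using \<epsilon>(2) \<phi> by (auto simp: linear_simps)
    define C where "C = \<pi> ` {x. \<epsilon> \<le> \<bar>apply_bcontfun d x\<bar>}"
    have "closed {x. \<epsilon> \<le> \<bar>apply_bcontfun d x\<bar>}"
      by (intro closed_Collect_le continuous_intros) auto
    then have "compact {x. \<epsilon> \<le> \<bar>apply_bcontfun d x\<bar>}"
      using compact_Int_closed[OF K] by simp
    then have "compact C"
      unfolding C_def by (rule compact_continuous_image[OF c\<pi>])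
    show ?thesis
    proof (rule M(2)[OF openA _ _ \<open>\<phi> (d - t) \<noteq> 0\<close>])
      show "closedin (top_of_set S) C"
        by (rule compact_imp_closedin_top_of_set[OF Hausdorff_space_euclidean_fun \<open>compact C\<close>])
          (auto simp: C_def S_def)
      show "C \<subseteq> A \<alpha>"
        using d(2) \<epsilon>(1) \<alpha> by (fastforce simp: C_def A_def S_def \<pi>_def)
      show "\<pi> x \<in> C" if "apply_bcontfun (d - t) x \<noteq> 0" for x
        using that \<epsilon>(1) by (auto simp: C_def t max_def min_def split: if_splits)
    qed
  qed
  moreover have "A \<alpha> \<in> sets M" for \<alpha>
    using M(1) openA by (auto simp: regular_Borel_probability_def)
  ultimately have "\<exists>y\<in>topspace (top_of_set S). |{\<alpha> \<in> Field \<kappa>. y \<in> A \<alpha>}| =o \<kappa>"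
    by (intro \<kappa>(2)[unfolded caliber_of_Radon_measures_def, rule_format, OF X M(1)]) simp
  then obtain y where y: "y \<in> S" "|{\<alpha> \<in> Field \<kappa>. y \<in> A \<alpha>}| =o \<kappa>"
    by auto
  obtain x where x: "y = \<pi> x"
    using y(1) by (auto simp: S_def)
  have "j ` {\<alpha> \<in> Field \<kappa>. y \<in> A \<alpha>} \<subseteq> {\<gamma> \<in> \<Gamma>. e x \<gamma> \<noteq> 0}"
    using j(2) by (auto simp: x A_def \<pi>_def)
  moreover have "inj_on j {\<alpha> \<in> Field \<kappa>. y \<in> A \<alpha>}"
    by (rule inj_on_subset[OF j(1)]) blast
  ultimately have "|{\<alpha> \<in> Field \<kappa>. y \<in> A \<alpha>}| \<le>o |{\<gamma> \<in> \<Gamma>. e x \<gamma> \<noteq> 0}|"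
    using card_of_ordLeq by blast
  then have "|{\<alpha> \<in> Field \<kappa>. y \<in> A \<alpha>}| <o \<kappa>"
    using e(2) ordLeq_ordLess_trans by blast
  then show False
    using y(2) not_ordLess_ordIso by blast
qed

text \<open>\<open>D\<close> is its own index set: each function is the coordinate it names.
  Compactness upgrades the continuous injection to a homeomorphism.\<close>

lemma Corson_compact_separating_family:
  assumes L: "compact (UNIV :: 'l::t2_space set)" and D: "separating_family \<kappa> (UNIV :: 'l set) D"
  shows "Corson_compact \<kappa> (euclidean :: 'l topology)"
proof -
  define g where "g y = (\<lambda>d\<in>D. d y)" for y :: 'l
  have X: "compact_space (euclidean :: 'l topology)" "Hausdorff_space (euclidean :: 'l topology)"
    using L by (simp_all add: compact_space_def Hausdorff_space_euclidean_t2)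
  have S: "range g \<subseteq> topspace (Sigma_space \<kappa> D)"
  proof
    fix z assume "z \<in> range g"
    then obtain y where y: "z = g y" by blast
    have "{d \<in> D. g y d \<noteq> 0} = {d \<in> D. d y \<noteq> 0}"
      by (auto simp: g_def)
    then have "|{d \<in> D. g y d \<noteq> 0}| <o \<kappa>"
      using D by (simp add: separating_family_def)
    then show "z \<in> topspace (Sigma_space \<kappa> D)"
      by (simp add: y Sigma_space_def g_def)
  qed
  let ?Y = "subtopology (Sigma_space \<kappa> D) (range g)"
  have "continuous_map euclidean (product_topology (\<lambda>_. euclideanreal) D) g"
    using D by (auto simp: continuous_map_componentwise separating_family_def g_def)
  then have "continuous_map euclidean ?Y g"
    using S by (auto simp: Sigma_space_def continuous_map_in_subtopology)
  moreover have "Hausdorff_space ?Y"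
    by (auto simp: Sigma_space_def Hausdorff_space_product_topology intro!: Hausdorff_space_subtopology)
  moreover have "g ` topspace euclidean = topspace ?Y"
    using S by auto
  moreover have "inj_on g (topspace euclidean)"
  proof (rule inj_onI)
    fix y y' assume "g y = g y'"
    then have "d y = d y'" if "d \<in> D" for d
      using that by (metis g_def restrict_apply')
    then show "y = y'"
      using D unfolding separating_family_def by blast
  qed
  ultimately have "homeomorphic_map euclidean ?Y g"
    using X(1) by (simp only: continuous_imp_homeomorphic_map)
  then have "(euclidean :: 'l topology) homeomorphic_space ?Y"
    by (rule homeomorphic_map_imp_homeomorphic_space)
  then show ?thesis
    by (rule Corson_compactI[OF X S])
qed

lemma Corson_compact_coordinates:
  assumes "Corson_compact \<kappa> (euclidean :: 'k::t2_space topology)"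
  obtains e :: "'k::t2_space \<Rightarrow> ('k \<Rightarrow> real) \<Rightarrow> real" and \<Gamma> where
    "\<And>\<gamma>. \<gamma> \<in> \<Gamma> \<Longrightarrow> continuous_on UNIV (\<lambda>x. e x \<gamma>)" "\<And>x. |{\<gamma> \<in> \<Gamma>. e x \<gamma> \<noteq> 0}| <o \<kappa>"
    "\<And>x y. x \<noteq> y \<Longrightarrow> \<exists>\<gamma>\<in>\<Gamma>. e x \<gamma> \<noteq> e y \<gamma>"
proof -
  obtain \<Gamma> :: "('k \<Rightarrow> real) set" and S where S: "S \<subseteq> topspace (Sigma_space \<kappa> \<Gamma>)"
    "(euclidean :: 'k topology) homeomorphic_space subtopology (Sigma_space \<kappa> \<Gamma>) S"
    using assms unfolding Corson_compact_def by blast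
  then obtain f where f: "homeomorphic_map (euclidean :: 'k topology) (subtopology (Sigma_space \<kappa> \<Gamma>) S) f"
    using homeomorphic_space by blast
  have cf: "continuous_map euclidean (product_topology (\<lambda>_. euclideanreal) \<Gamma>) f"
    using homeomorphic_imp_continuous_map[OF f] by (simp add: Sigma_space_def continuous_map_in_subtopology)
  have "f x \<in> S" for x
    using homeomorphic_imp_surjective_map[OF f] by auto
  then have fSig: "f x \<in> topspace (Sigma_space \<kappa> \<Gamma>)" for x
    using S(1) by blast
  have inj: "inj f"
    using homeomorphic_imp_injective_map[OF f] by simp
  show ?thesis
  proof
    show "continuous_on UNIV (\<lambda>x. f x \<gamma>)" if "\<gamma> \<in> \<Gamma>" for \<gamma>
      using cf that by (auto simp: continuous_map_componentwise)
    show "|{\<gamma> \<in> \<Gamma>. f x \<gamma> \<noteq> 0}| <o \<kappa>" for x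
      using fSig[of x] by (simp add: Sigma_space_def)
    show "\<exists>\<gamma>\<in>\<Gamma>. f x \<gamma> \<noteq> f y \<gamma>" if "x \<noteq> y" for x y
    proof (rule ccontr)
      assume "\<not> ?thesis"
      moreover have "f x \<in> extensional \<Gamma>" "f y \<in> extensional \<Gamma>"
        using fSig by (auto simp: Sigma_space_def PiE_def)
      ultimately have "f x = f y"
        by (meson extensionalityI)
      then show False
        using inj that by (auto dest: injD)
    qed
  qed
qed

subsection \<open>Monomials and the main theorem\<close>

text \<open>Repetition in the list gives powers, and the empty list the constant 1. Lists also let
  \<open>small_lists\<close> count the monomials over a small set of coordinates.\<close>

definition monomial :: "('k::topological_space \<Rightarrow> 'g \<Rightarrow> real) \<Rightarrow> 'g list \<Rightarrow> 'k \<Rightarrow>\<^sub>C real" where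
  "monomial e l = Bcontfun (\<lambda>x. prod_list (map (e x) l))"

lemma monomial_apply:
  fixes e :: "'k::topological_space \<Rightarrow> 'g \<Rightarrow> real"
  assumes "compact (UNIV :: 'k set)" "\<And>\<gamma>. \<gamma> \<in> \<Gamma> \<Longrightarrow> continuous_on UNIV (\<lambda>x. e x \<gamma>)" "l \<in> lists \<Gamma>"
  shows "apply_bcontfun (monomial e l) x = prod_list (map (e x) l)"
proof -
  have "continuous_on UNIV (\<lambda>x. prod_list (map (e x) l))"
    using assms(3) by (induction l) (auto intro!: continuous_intros assms(2))
  then show ?thesis
    unfolding monomial_def by (simp add: bcontfun_of_continuous[OF assms(1)])
qed

text \<open>Stone-Weierstrass: concatenation of lists makes the span of the monomials an algebra,
  which contains the constants and separates points, so it is uniformly dense.\<close>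

lemma functional_zero_if_zero_on_monomials:
  fixes e :: "'k::t2_space \<Rightarrow> 'g \<Rightarrow> real" and \<psi> :: "('k \<Rightarrow>\<^sub>C real) \<Rightarrow> real"
  assumes K: "compact (UNIV :: 'k set)"
    and e: "\<And>\<gamma>. \<gamma> \<in> \<Gamma> \<Longrightarrow> continuous_on UNIV (\<lambda>x. e x \<gamma>)" "\<And>x y. x \<noteq> y \<Longrightarrow> \<exists>\<gamma>\<in>\<Gamma>. e x \<gamma> \<noteq> e y \<gamma>"
    and \<psi>: "bounded_linear \<psi>" "\<And>l. l \<in> lists \<Gamma> \<Longrightarrow> \<psi> (monomial e l) = 0"
  shows "\<psi> g = 0"
proof -
  define V where "V = span (monomial e ` lists \<Gamma>)"
  have mono: "apply_bcontfun (monomial e l) x = prod_list (map (e x) l)" if "l \<in> lists \<Gamma>" for l x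
    by (rule monomial_apply[OF K e(1) that])
  have \<psi>V: "\<psi> h = 0" if "h \<in> V" for h
    by (rule linear_eq_0_on_span[OF bounded_linear.linear[OF \<psi>(1)] _ that[unfolded V_def]])
      (use \<psi>(2) in blast)
  have Vm: "monomial e l \<in> V" if "l \<in> lists \<Gamma>" for l
    unfolding V_def using that by (intro span_base) auto
  have mult1: "\<exists>h'\<in>V. \<forall>x. apply_bcontfun h' x = apply_bcontfun (monomial e l) x * apply_bcontfun h x"
    if l: "l \<in> lists \<Gamma>" and h: "h \<in> V" for l h
    using h unfolding V_def
  proof (induction rule: span_induct_alt)
    case base
    show ?case
      using span_zero by (intro bexI[of _ 0]) auto
  next
    case (step c m h)
    then obtain l' h' where l': "m = monomial e l'" "l' \<in> lists \<Gamma>" and h': "h' \<in> V"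
      "\<And>x. apply_bcontfun h' x = apply_bcontfun (monomial e l) x * apply_bcontfun h x"
      unfolding V_def by auto
    have "c *\<^sub>R monomial e (l @ l') + h' \<in> V"
      using l l' h' Vm[of "l @ l'"] unfolding V_def by (intro span_add span_scale) auto
    moreover have "apply_bcontfun (c *\<^sub>R monomial e (l @ l') + h') x
        = apply_bcontfun (monomial e l) x * apply_bcontfun (c *\<^sub>R m + h) x" for x
      using l l' h' by (simp add: mono algebra_simps)
    ultimately show ?case
      unfolding V_def by blast
  qed
  have mult: "\<exists>h'\<in>V. \<forall>x. apply_bcontfun h' x = apply_bcontfun f x * apply_bcontfun h x"
    if f: "f \<in> V" and h: "h \<in> V" for f h
    using f unfolding V_def
  proof (induction rule: span_induct_alt)
    case base
    show ?case
      using span_zero by (intro bexI[of _ 0]) auto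
  next
    case (step c m f)
    then obtain f' where f': "f' \<in> V" "\<And>x. apply_bcontfun f' x = apply_bcontfun f x * apply_bcontfun h x"
      unfolding V_def by auto
    obtain h' where h': "h' \<in> V" "\<And>x. apply_bcontfun h' x = apply_bcontfun m x * apply_bcontfun h x"
      using step mult1[OF _ h] by blast
    have "c *\<^sub>R h' + f' \<in> V"
      using f' h' unfolding V_def by (intro span_add span_scale) auto
    moreover have "apply_bcontfun (c *\<^sub>R h' + f') x = apply_bcontfun (c *\<^sub>R m + f) x * apply_bcontfun h x" for x
      using f' h' by (simp add: algebra_simps)
    ultimately show ?case
      unfolding V_def by blast
  qed
  interpret function_ring_on "apply_bcontfun ` V" "UNIV :: 'k set"
  proof
    show "compact (UNIV :: 'k set)" by (rule K)
    show "continuous_on UNIV f" if "f \<in> apply_bcontfun ` V" for f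
      using that by auto
    show "(\<lambda>x. f x + h x) \<in> apply_bcontfun ` V" if fh: "f \<in> apply_bcontfun ` V" "h \<in> apply_bcontfun ` V" for f h
    proof -
      obtain f' h' where "f = apply_bcontfun f'" "h = apply_bcontfun h'" "f' \<in> V" "h' \<in> V"
        using fh by blast
      then show ?thesis
        by (intro image_eqI[of _ _ "f' + h'"]) (auto simp: V_def span_add)
    qed
    show "(\<lambda>x. f x * h x) \<in> apply_bcontfun ` V" if fh: "f \<in> apply_bcontfun ` V" "h \<in> apply_bcontfun ` V" for f h
    proof -
      obtain f' h' where fh': "f = apply_bcontfun f'" "h = apply_bcontfun h'" "f' \<in> V" "h' \<in> V"
        using fh by blast
      obtain k where "k \<in> V" "\<And>x. apply_bcontfun k x = apply_bcontfun f' x * apply_bcontfun h' x"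
        using mult[OF fh'(3,4)] by blast
      then show ?thesis
        by (intro image_eqI[of _ _ k]) (auto simp: fh')
    qed
    show "(\<lambda>_. c) \<in> apply_bcontfun ` V" for c :: real
      by (rule image_eqI[of _ _ "c *\<^sub>R monomial e []"])
        (auto simp: mono[of "[]"] V_def intro!: span_scale Vm[unfolded V_def])
    show "\<exists>f\<in>apply_bcontfun ` V. f x \<noteq> f y" if xy: "x \<noteq> y" for x y
    proof -
      obtain \<gamma> where \<gamma>: "\<gamma> \<in> \<Gamma>" "e x \<gamma> \<noteq> e y \<gamma>"
        using e(2)[OF xy] by blast
      then show ?thesis
        using Vm[of "[\<gamma>]"] by (intro bexI[of _ "apply_bcontfun (monomial e [\<gamma>])"]) (auto simp: mono[of "[\<gamma>]"])
    qed
  qed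
  obtain B where B: "\<And>g. \<bar>\<psi> g\<bar> \<le> B * norm g" "B > 0"
    using bounded_linear.pos_bounded[OF \<psi>(1)] by (metis mult.commute real_norm_def)
  have "\<bar>\<psi> g\<bar> \<le> 0 + \<epsilon>" if \<epsilon>: "\<epsilon> > 0" for \<epsilon>
  proof -
    obtain h where h: "h \<in> V" "\<And>x. \<bar>apply_bcontfun g x - apply_bcontfun h x\<bar> < \<epsilon> / B"
      using Stone_Weierstrass_basic[of "apply_bcontfun g" "\<epsilon> / B"] \<epsilon> B(2) by fastforce
    have "norm (g - h) \<le> \<epsilon> / B"
      by (rule norm_bound) (use h(2) in \<open>auto intro: less_imp_le\<close>)
    then have "B * norm (g - h) \<le> \<epsilon>"
      using B(2) by (simp add: field_simps)
    then have "\<bar>\<psi> (g - h)\<bar> \<le> \<epsilon>"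
      using B(1)[of "g - h"] by linarith
    then show ?thesis
      using \<psi>(1) \<psi>V[OF h(1)] by (simp add: linear_simps)
  qed
  then have "\<bar>\<psi> g\<bar> \<le> 0"
    by (rule field_le_epsilon)
  then show ?thesis by simp
qed

text \<open>Banach-Alaoglu with the evaluation point carried along: a product of compact intervals
  and \<open>'l\<close> is compact by Tychonoff, and linearity and the evaluation identity are
  closed conditions on the pair.\<close>

lemma compact_evaluation_graph:
  fixes T :: "('l::t2_space \<Rightarrow>\<^sub>C real) \<Rightarrow> 'b::real_normed_vector"
  assumes "compact (UNIV :: 'l set)"
  shows "compact {p :: ('b \<Rightarrow> real) \<times> 'l. (\<forall>v. \<bar>fst p v\<bar> \<le> m v) \<and> (\<forall>v w. fst p (v + w) = fst p v + fst p w) \<and>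
    (\<forall>r v. fst p (r *\<^sub>R v) = r * fst p v) \<and> (\<forall>g. fst p (T g) = apply_bcontfun g (snd p))}"
    (is "compact ?G")
proof -
  have c: "continuous_on UNIV (\<lambda>p :: ('b \<Rightarrow> real) \<times> 'l. fst p v)" for v
    by (intro continuous_on_product_then_coordinatewise[of UNIV fst] continuous_on_fst continuous_on_id)
  have cg: "continuous_on UNIV (\<lambda>p :: ('b \<Rightarrow> real) \<times> 'l. apply_bcontfun g (snd p))" for g
    by (rule continuous_on_compose2[OF continuous_on_apply_bcontfun[of UNIV]])
      (auto intro: continuous_on_snd continuous_on_id)
  define Z where "Z = (\<Inter>v. \<Inter>w. {p :: ('b \<Rightarrow> real) \<times> 'l. fst p (v + w) = fst p v + fst p w}) \<inter>
    (\<Inter>r. \<Inter>v. {p. fst p (r *\<^sub>R v) = r * fst p v}) \<inter> (\<Inter>g. {p. fst p (T g) = apply_bcontfun g (snd p)})"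
  have "closed Z"
    unfolding Z_def
    by (intro closed_Int closed_INT ballI closed_Collect_eq c cg continuous_on_add continuous_on_mult continuous_on_const)
  define P where "P = {\<phi> :: 'b \<Rightarrow> real. \<forall>v. \<bar>\<phi> v\<bar> \<le> m v}"
  have "compactin (product_topology (\<lambda>_. euclideanreal) (UNIV :: 'b set)) (PiE UNIV (\<lambda>v. {- m v..m v}))"
    by (simp add: compactin_PiE)
  moreover have "PiE UNIV (\<lambda>v. {- m v..m v}) = P"
    by (simp add: P_def PiE_UNIV_domain Pi_def abs_le_iff minus_le_iff conj_commute)
  ultimately have "compact P"
    by (simp add: euclidean_product_topology)
  then have "compact (P \<times> (UNIV :: 'l set))"
    using assms by (rule compact_Times)
  then have "compact (P \<times> (UNIV :: 'l set) \<inter> Z)"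
    using \<open>closed Z\<close> by (rule compact_Int_closed)
  moreover have "P \<times> (UNIV :: 'l set) \<inter> Z = ?G"
    by (simp add: P_def Z_def set_eq_iff mem_Times_iff)
  ultimately show ?thesis by simp
qed

theorem theorem13p3:
  fixes \<kappa> :: "'c rel"
    and T :: "('l::t2_space \<Rightarrow>\<^sub>C real) \<Rightarrow> ('k::t2_space \<Rightarrow>\<^sub>C real)"
  assumes "regular_cardinal \<kappa>"
    and "caliber_of_Radon_measures \<kappa>"
    and "compact (UNIV :: 'k set)"
    and "compact (UNIV :: 'l set)"
    and "Corson_compact \<kappa> (euclidean :: 'k topology)"
    and "isomorphic_embedding T"
  shows "Corson_compact \<kappa> (euclidean :: 'l topology)"
proof -
  have \<kappa>: "Cinfinite \<kappa>" "uncountable_regular \<kappa>"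
    using assms(1) caliber_uncountable[OF _ assms(2)]
    by (auto simp: regular_cardinal_def uncountable_regular_def)
  note K = assms(3) and L = assms(4)
  obtain e :: "'k \<Rightarrow> ('k \<Rightarrow> real) \<Rightarrow> real" and \<Gamma> where
    e: "\<And>\<gamma>. \<gamma> \<in> \<Gamma> \<Longrightarrow> continuous_on UNIV (\<lambda>x. e x \<gamma>)" "\<And>x. |{\<gamma> \<in> \<Gamma>. e x \<gamma> \<noteq> 0}| <o \<kappa>"
      "\<And>x y. x \<noteq> y \<Longrightarrow> \<exists>\<gamma>\<in>\<Gamma>. e x \<gamma> \<noteq> e y \<gamma>"
    by (rule Corson_compact_coordinates[OF assms(5)]) blast
  obtain c where T: "bounded_linear T" "c > 0" "\<And>g. c * norm g \<le> norm (T g)"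
    using assms(6) unfolding isomorphic_embedding_def by blast
  \<comment> \<open>All extensions of bound 1/c are kept, each paired with its point of L. The
    pairing makes the passage to the point a continuous projection.\<close>
  define G where "G = {p :: (('k \<Rightarrow>\<^sub>C real) \<Rightarrow> real) \<times> 'l. (\<forall>v. \<bar>fst p v\<bar> \<le> norm v / c) \<and>
    (\<forall>v w. fst p (v + w) = fst p v + fst p w) \<and> (\<forall>r v. fst p (r *\<^sub>R v) = r * fst p v) \<and>
    (\<forall>g. fst p (T g) = apply_bcontfun g (snd p))}"
  have "compact G"
    unfolding G_def by (rule compact_evaluation_graph[OF L])
  have bl: "bounded_linear \<phi>" if "(\<phi>, y) \<in> G" for \<phi> y
    by (rule bounded_linear_intro[where K = "1 / c"]) (use that in \<open>auto simp: G_def\<close>)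
  define q where "q p = (\<lambda>l. if l \<in> lists \<Gamma> then fst p (monomial e l) else 0)"
    for p :: "(('k \<Rightarrow>\<^sub>C real) \<Rightarrow> real) \<times> 'l"
  have cq: "continuous_on G q"
  proof (rule continuous_on_coordinatewise_then_product)
    fix l
    have "continuous_on G (\<lambda>p. fst p (monomial e l))"
      by (intro continuous_on_product_then_coordinatewise[of G fst] continuous_on_fst continuous_on_id)
    then show "continuous_on G (\<lambda>p. q p l)"
      by (cases "l \<in> lists \<Gamma>") (auto simp: q_def)
  qed
  \<comment> \<open>Values on monomials determine the functional, its values on the range of
    \<open>T\<close> determine evaluation at the point, and continuous functions separate the points
    of L.\<close>
  have q_inj: "y = y'" if p: "(\<phi>, y) \<in> G" "(\<phi>', y') \<in> G" "q (\<phi>, y) = q (\<phi>', y')" for \<phi> \<phi>' y y'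
  proof (rule ccontr)
    assume "y \<noteq> y'"
    then obtain u where u: "continuous_on UNIV u" "(u y :: real) \<noteq> u y'"
      using compact_separating_function[OF L UNIV_I UNIV_I] by blast
    have "\<phi> (monomial e l) - \<phi>' (monomial e l) = 0" if "l \<in> lists \<Gamma>" for l
      using fun_cong[OF p(3), of l] that by (simp add: q_def)
    then have "\<phi> v - \<phi>' v = 0" for v
      using functional_zero_if_zero_on_monomials[OF K e(1,3) bounded_linear_sub[OF bl[OF p(1)] bl[OF p(2)]]]
      by simp
    then have "\<phi> (T (Bcontfun u)) = \<phi>' (T (Bcontfun u))"
      by simp
    then show False
      using p(1,2) u(2) by (simp add: G_def bcontfun_of_continuous[OF L u(1)])
  qed
  \<comment> \<open>By \<open>q_inj\<close> every preimage under \<open>q\<close> gives the same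
    point, so the projection to L factors as \<open>f\<close> after \<open>q\<close>; compactness of
    \<open>G\<close> then makes \<open>f\<close> continuous.\<close>
  define f where "f z = snd (inv_into G q z)" for z
  have f: "f (q p) = snd p" if p: "p \<in> G" for p
  proof -
    have "inv_into G q (q p) \<in> G" "q (inv_into G q (q p)) = q p"
      using p by (auto simp: inv_into_into f_inv_into_f)
    then show ?thesis
      unfolding f_def using q_inj p by (metis prod.collapse)
  qed
  have "continuous_on (q ` G) f"
    by (rule continuous_on_compact_factor[where g = snd, OF Hausdorff_space_euclidean_fun \<open>compact G\<close> cq])
      (simp_all add: f continuous_on_snd continuous_on_id)
  moreover have "compact (q ` G)"
    by (rule compact_continuous_image[OF cq \<open>compact G\<close>])
  moreover have "|{l. u l \<noteq> 0}| <o \<kappa>" if u: "u \<in> q ` G" for u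
  proof -
    obtain \<phi> y where \<phi>: "(\<phi>, y) \<in> G" "u = q (\<phi>, y)"
      using u by force
    let ?N = "{\<gamma> \<in> \<Gamma>. \<exists>d. \<phi> d \<noteq> 0 \<and> (\<forall>x. apply_bcontfun d x \<noteq> 0 \<longrightarrow> e x \<gamma> \<noteq> 0)}"
    have "|?N| <o \<kappa>"
      by (rule small_functional_support[OF \<kappa>(1) assms(2) K e(1,2) bl[OF \<phi>(1)]])
    then have "|lists ?N| <o \<kappa>"
      by (rule small_lists[OF \<kappa>(2)])
    \<comment> \<open>A monomial vanishes wherever one of its factors does, so it is itself the
      witness \<open>d\<close> for each coordinate in it.\<close>
    moreover have "{l. u l \<noteq> 0} \<subseteq> lists ?N"
    proof
      fix l assume "l \<in> {l. u l \<noteq> 0}"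
      then have l: "l \<in> lists \<Gamma>" "\<phi> (monomial e l) \<noteq> 0"
        by (auto simp: \<phi>(2) q_def split: if_splits)
      have mono: "apply_bcontfun (monomial e l) x = prod_list (map (e x) l)" for x
        by (rule monomial_apply[OF K e(1) l(1)])
      have "\<gamma> \<in> ?N" if "\<gamma> \<in> set l" for \<gamma>
      proof -
        have "e x \<gamma> \<noteq> 0" if "apply_bcontfun (monomial e l) x \<noteq> 0" for x
          using that \<open>\<gamma> \<in> set l\<close> by (force simp: mono prod_list_zero_iff)
        then show ?thesis
          using l that by blast
      qed
      then show "l \<in> lists ?N"
        by blast
    qed
    ultimately show ?thesis
      by (rule small_subset)
  qed
  ultimately obtain D where "separating_family \<kappa> (f ` q ` G) D"
    using separating_family_continuous_image[OF \<kappa>(2)] by blast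
  moreover have "f ` q ` G = UNIV"
  proof -
    have "\<exists>p\<in>G. snd p = y" for y
    proof -
      have "linear (\<lambda>g :: 'l \<Rightarrow>\<^sub>C real. apply_bcontfun g y)"
        by (intro linearI) auto
      moreover have "\<bar>apply_bcontfun g y\<bar> \<le> norm g" for g :: "'l \<Rightarrow>\<^sub>C real"
        using norm_bounded[of g y] by simp
      ultimately obtain \<phi> where "linear \<phi>" "\<And>v. \<bar>\<phi> v\<bar> \<le> norm v / c" "\<And>g. \<phi> (T g) = apply_bcontfun g y"
        using functional_extension_embedding[OF bounded_linear.linear[OF T(1)] T(2,3)] by blast
      then have "(\<phi>, y) \<in> G"
        by (simp add: G_def linear_add linear_scale)
      then show ?thesis
        by (intro bexI[of _ "(\<phi>, y)"]) auto
    qed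
    then show ?thesis
      using f by (auto simp: image_image) (metis image_eqI)
  qed
  ultimately show ?thesis
    using Corson_compact_separating_family[OF L] by simp
qed

end
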